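(* Let $S=\{s_1,\dots,s_u,0,s_{u+1},\dots,s_n\}$ be a centred Catalan set with $s_1<\dots<s_u\le -1$ and $1\le s_{u+1}<\dots<s_n$, and let $l$ be a positive integer. The number $w_l(S)$ of $(n,l)$-AS-trapezoids $A$ with $\mathcal{S}(A)=S$ is equal to the constant term in $x_1,\dots,x_n$ of \[ \prod_{i=1}^n x_i^{-n-s_i}\prod_{i=u+1}^n x_i^{2-l}(1+x_i)^l\prod_{1\le i<j\le n}(x_j-x_i)(1+x_i+x_ix_j). \]
   Context: A centred Catalan set of size $m$ is an $m$-subset $S$ of $\{-m+1,\dots,m-1\}$ with $|S\cap\{-i,\dots,i\}|\ge i+1$ for all $0\le i\le m-1$. Let $n,l$ be positive integers. An $(n,l)$-AS-trapezoid is an array of $n$ centred rows, the $i$-th row from the bottom having $l+2i-1$ entries from $\{-1,0,1\}$, such that all row sums are $1$, the column sums of the central $l-1$ columns are $0$, the nonzero entries in every row and in every column alternate in sign, and in every column the first nonzero entry from the top is positive. Label the columns $-n+1,\dots,l+n-1$ from left to right. $\mathcal{S}(A)$ is $\{0\}\cup\{c-1: c\le 0,\ \text{column } c\text{ has positive sum}\}\cup\{c-(l-1): c\ge1,\ \text{column } c\text{ has positive sum}\}$, a centred Catalan set of size $n+1$. *)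

theory Defs
  imports "HOL-Library.Poly_Mapping"
begin

definition centred_Catalan_set :: "nat \<Rightarrow> int set \<Rightarrow> bool" where
  "centred_Catalan_set m S \<longleftrightarrow>
     S \<subseteq> {- int m + 1..int m - 1} \<and> card S = m \<and>
     (\<forall>i<m. i + 1 \<le> card (S \<inter> {- int i..int i}))"

text \<open>
  Rows are numbered from bottom to top by \<open>1, \<dots>, n\<close> and columns from left to right by
  \<open>-n+1, \<dots>, l+n-1\<close>. Since the rows are centred, row \<open>i\<close>, which has \<open>l + 2i - 1\<close> entries,
  occupies the columns \<open>-i+1, \<dots>, l+i-1\<close>.
\<close>

definition row_cols :: "nat \<Rightarrow> nat \<Rightarrow> int set" where
  "row_cols l i = {- int i + 1..int l + int i - 1}"

definition trapezoid_cols :: "nat \<Rightarrow> nat \<Rightarrow> int set" where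
  "trapezoid_cols n l = {- int n + 1..int l + int n - 1}"

definition col_rows :: "nat \<Rightarrow> nat \<Rightarrow> int \<Rightarrow> nat set" where
  "col_rows n l c = {i \<in> {1..n}. c \<in> row_cols l i}"

definition col_sum :: "nat \<Rightarrow> nat \<Rightarrow> (nat \<Rightarrow> int \<Rightarrow> int) \<Rightarrow> int \<Rightarrow> int" where
  "col_sum n l A c = (\<Sum>i\<in>col_rows n l c. A i c)"

definition alternates_on :: "'a::linorder set \<Rightarrow> ('a \<Rightarrow> int) \<Rightarrow> bool" where
  "alternates_on I f \<longleftrightarrow>
     (\<forall>a\<in>I. \<forall>b\<in>I. a < b \<and> f a \<noteq> 0 \<and> f b \<noteq> 0 \<and> (\<forall>k\<in>I. a < k \<and> k < b \<longrightarrow> f k = 0)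
        \<longrightarrow> sgn (f b) = - sgn (f a))"

text \<open>
  The array is a function \<open>A\<close> whose value \<open>A i c\<close> is the entry in row \<open>i\<close> and column \<open>c\<close>.
  Values outside the trapezoidal shape are fixed to be \<open>0\<close>, so that each array is represented
  by exactly one function.
\<close>

definition AS_trapezoid :: "nat \<Rightarrow> nat \<Rightarrow> (nat \<Rightarrow> int \<Rightarrow> int) \<Rightarrow> bool" where
  "AS_trapezoid n l A \<longleftrightarrow>
     (\<forall>i c. i \<notin> {1..n} \<or> c \<notin> row_cols l i \<longrightarrow> A i c = 0) \<and>
     (\<forall>i\<in>{1..n}. \<forall>c\<in>row_cols l i. A i c \<in> {-1, 0, 1}) \<and>
     (\<forall>i\<in>{1..n}. (\<Sum>c\<in>row_cols l i. A i c) = 1) \<and>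
     (\<forall>c\<in>{1..int l - 1}. col_sum n l A c = 0) \<and>
     (\<forall>i\<in>{1..n}. alternates_on (row_cols l i) (A i)) \<and>
     (\<forall>c\<in>trapezoid_cols n l. alternates_on (col_rows n l c) (\<lambda>i. A i c)) \<and>
     (\<forall>c\<in>trapezoid_cols n l. \<forall>i\<in>col_rows n l c.
        A i c \<noteq> 0 \<and> (\<forall>k\<in>col_rows n l c. i < k \<longrightarrow> A k c = 0) \<longrightarrow> A i c > 0)"

definition trapezoid_set :: "nat \<Rightarrow> nat \<Rightarrow> (nat \<Rightarrow> int \<Rightarrow> int) \<Rightarrow> int set" where
  "trapezoid_set n l A =
     {0} \<union> {c - 1 | c. c \<in> trapezoid_cols n l \<and> c \<le> 0 \<and> col_sum n l A c > 0}
         \<union> {c - (int l - 1) | c. c \<in> trapezoid_cols n l \<and> c \<ge> 1 \<and> col_sum n l A c > 0}"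

definition AS_trapezoid_count :: "nat \<Rightarrow> nat \<Rightarrow> int set \<Rightarrow> nat" where
  "AS_trapezoid_count n l S = card {A. AS_trapezoid n l A \<and> trapezoid_set n l A = S}"

text \<open>
  Laurent polynomials over the integers in variables \<open>x\<^sub>i\<close> indexed by natural numbers: a
  monomial is a finitely supported exponent vector with integer exponents.
\<close>

type_synonym laurent = "(nat \<Rightarrow>\<^sub>0 int) \<Rightarrow>\<^sub>0 int"

definition var_powi :: "nat \<Rightarrow> int \<Rightarrow> laurent" where
  "var_powi i k = Poly_Mapping.single (Poly_Mapping.single i k) 1"

abbreviation var :: "nat \<Rightarrow> laurent" where
  "var i \<equiv> var_powi i 1"

definition constant_term :: "laurent \<Rightarrow> int" where
  "constant_term p = Poly_Mapping.lookup p 0"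

end

theory Submission
  imports Defs "HOL-Computational_Algebra.Polynomial"
begin

text \<open>
  Reading the rows from top to bottom, the columns with partial sum 1 form a set that grows by one
  element per row, and consecutive sets interlace. Removing the bottom row of a trapezoid therefore
  gives a recursion for the number of trapezoids with a prescribed set of columns of sum 1; the
  remaining rows form a trapezoid with \<open>l\<close> replaced by \<open>l + 2\<close>.

  The constant term satisfies the same recursion if column \<open>k\<close> is given the weight
  \<open>x\<^bsup>-k\<^esup>\<close> for \<open>k < 0\<close>, \<open>E\<^bsup>k\<^esup>\<close> for \<open>0 \<le> k \<le> l\<close> and \<open>x\<^bsup>l-k\<^esup> E\<^bsup>l\<^esup>\<close> for \<open>k > l\<close>, where \<open>E = 1 + 1/x\<close>.
  Let \<open>t\<^sub>i = -1 - 1/x\<^sub>i\<close> for the variables of negative columns and \<open>t\<^sub>i = x\<^sub>i\<close> for all others.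
  Then each factor \<open>(x\<^sub>j - x\<^sub>i)(1 + x\<^sub>i + x\<^sub>i x\<^sub>j)\<close> equals \<open>x\<^sub>i x\<^sub>j (t\<^sub>j - t\<^sub>i)\<close> times a polynomial in
  the negative-column variables and the inverses of the others. Expand the Vandermonde product of
  the \<open>1 + t\<^sub>i\<close> along the column of ones. If the entry 1 is taken from a negative column, only
  positive powers of that variable occur; otherwise only nonpositive powers of the variable occur, so
  that it may be set to infinity. This expresses the constant term in \<open>n\<close> variables as an alternating
  sum of constant terms in \<open>n - 1\<close> variables. The alternating sum equals the sum over all interlacing
  rows because the integrand times \<open>1 + x\<^sub>j + x\<^sub>i x\<^sub>j\<close>, for neighbours \<open>i\<close>, \<open>j\<close>, is antisymmetric in them.
\<close>

section \<open>Products over pairs and the Vandermonde product\<close>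

abbreviation index_pairs :: "nat \<Rightarrow> (nat \<times> nat) set" where
  "index_pairs m \<equiv> {(i, j). i < j \<and> j < m}"

lemma finite_index_pairs [simp]: "finite (index_pairs m)"
  by (rule finite_subset[of _ "{..<m} \<times> {..<m}"]) auto

text \<open>The increasing enumeration of the naturals other than \<open>p\<close>. It renumbers the
  variables that remain when variable \<open>p\<close> is deleted.\<close>

definition skip :: "nat \<Rightarrow> nat \<Rightarrow> nat" where
  "skip p i = (if i < p then i else Suc i)"

lemma inj_skip: "inj (skip p)"
  by (auto simp: inj_def skip_def split: if_splits)

lemma skip_neq [simp]: "skip p i \<noteq> p"
  by (auto simp: skip_def)

lemma skip_less_iff [simp]: "skip p i < skip p j \<longleftrightarrow> i < j"
  by (auto simp: skip_def)

lemma skip_image: "p < Suc m \<Longrightarrow> skip p ` {..<m} = {..<Suc m} - {p}"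
proof (intro set_eqI iffI)
  fix x assume p: "p < Suc m" and x: "x \<in> {..<Suc m} - {p}"
  show "x \<in> skip p ` {..<m}"
  proof (cases "x < p")
    case True
    then show ?thesis using x p by (intro image_eqI[of _ _ x]) (auto simp: skip_def)
  next
    case False
    then show ?thesis using x p by (intro image_eqI[of _ _ "x - 1"]) (auto simp: skip_def)
  qed
qed (auto simp: skip_def split: if_splits)

lemma prod_skip:
  fixes G :: "nat \<Rightarrow> 'a::comm_monoid_mult"
  assumes "p < Suc m"
  shows "(\<Prod>i<m. G (skip p i)) = (\<Prod>i\<in>{..<Suc m} - {p}. G i)"
  using prod.reindex[OF inj_on_subset[OF inj_skip subset_UNIV], of G p "{..<m}"] skip_image[OF assms]
  by simp

text \<open>The pairs avoiding \<open>p\<close> are the image of the pairs below \<open>m\<close>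
  under \<open>skip p\<close>; every other pair has \<open>p\<close> as its larger or its smaller
  entry.\<close>

lemma prod_pairs_skip:
  fixes F :: "nat \<Rightarrow> nat \<Rightarrow> 'a::comm_monoid_mult"
  assumes p: "p < Suc m"
  shows "(\<Prod>(i, j)\<in>index_pairs (Suc m). F i j) =
    (\<Prod>(i, j)\<in>index_pairs m. F (skip p i) (skip p j)) *
    ((\<Prod>i<p. F i p) * (\<Prod>j\<in>{p<..<Suc m}. F p j))"
proof -
  let ?s = "\<lambda>(i, j). (skip p i, skip p j)"
  have inj: "inj_on ?s (index_pairs m)"
    using inj_skip[of p] by (auto simp: inj_on_def inj_def)
  have im: "?s ` index_pairs m = {(i, j) \<in> index_pairs (Suc m). i \<noteq> p \<and> j \<noteq> p}"
  proof (intro set_eqI iffI)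
    fix x assume "x \<in> {(i, j) \<in> index_pairs (Suc m). i \<noteq> p \<and> j \<noteq> p}"
    then obtain i j where x: "x = (i, j)" "i < j" "j < Suc m" "i \<noteq> p" "j \<noteq> p" by auto
    then have "i \<in> skip p ` {..<m}" "j \<in> skip p ` {..<m}"
      unfolding skip_image[OF p] by auto
    then obtain i' j' where "i = skip p i'" "j = skip p j'" "i' < m" "j' < m"
      by blast
    then show "x \<in> ?s ` index_pairs m"
      using x by (intro image_eqI[of _ _ "(i', j')"]) auto
  next
    fix x assume "x \<in> ?s ` index_pairs m"
    then obtain i j where "x = (skip p i, skip p j)" "i < j" "j < m" by auto
    then show "x \<in> {(i, j) \<in> index_pairs (Suc m). i \<noteq> p \<and> j \<noteq> p}"
      by (simp add: skip_def)
  qed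
  have dec: "index_pairs (Suc m) = ?s ` index_pairs m \<union> ((\<lambda>i. (i, p)) ` {..<p} \<union> Pair p ` {p<..<Suc m})"
    unfolding im using p by auto
  have "(\<Prod>(i, j)\<in>index_pairs (Suc m). F i j) = (\<Prod>(i, j)\<in>?s ` index_pairs m. F i j) *
     (\<Prod>(i, j)\<in>(\<lambda>i. (i, p)) ` {..<p} \<union> Pair p ` {p<..<Suc m}. F i j)"
    unfolding dec by (rule prod.union_disjoint) (simp, simp, auto simp: im)
  also have "(\<Prod>(i, j)\<in>(\<lambda>i. (i, p)) ` {..<p} \<union> Pair p ` {p<..<Suc m}. F i j) =
     (\<Prod>(i, j)\<in>(\<lambda>i. (i, p)) ` {..<p}. F i j) * (\<Prod>(i, j)\<in>Pair p ` {p<..<Suc m}. F i j)"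
    by (rule prod.union_disjoint) auto
  also have "(\<Prod>(i, j)\<in>?s ` index_pairs m. F i j) = (\<Prod>(i, j)\<in>index_pairs m. F (skip p i) (skip p j))"
    by (subst prod.reindex[OF inj], rule prod.cong) auto
  finally show ?thesis
    by (simp add: prod.reindex inj_on_def)
qed

lemma prod_pairs_Suc:
  fixes F :: "nat \<Rightarrow> nat \<Rightarrow> 'a::comm_monoid_mult"
  shows "(\<Prod>(i, j)\<in>index_pairs (Suc m). F i j) = (\<Prod>(i, j)\<in>index_pairs m. F i j) * (\<Prod>i<m. F i m)"
proof -
  have "(\<Prod>(i, j)\<in>index_pairs m. F (skip m i) (skip m j)) = (\<Prod>(i, j)\<in>index_pairs m. F i j)"
    by (rule prod.cong) (auto simp: skip_def)
  then show ?thesis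
    using prod_pairs_skip[of m m F] by (simp add: atLeastSucLessThan_greaterThanLessThan[symmetric])
qed

text \<open>Each index below \<open>m\<close> lies in exactly \<open>m - 1\<close> pairs.\<close>

lemma prod_pairs_mult:
  fixes g :: "nat \<Rightarrow> 'a::comm_monoid_mult"
  shows "(\<Prod>(i, j)\<in>index_pairs m. g i * g j) = (\<Prod>i<m. g i ^ (m - 1))"
proof (induction m)
  case (Suc m)
  have "(\<Prod>(i, j)\<in>index_pairs (Suc m). g i * g j) = (\<Prod>i<m. g i ^ (m - 1)) * ((\<Prod>i<m. g i) * g m ^ m)"
    unfolding prod_pairs_Suc Suc.IH by (simp add: prod.distrib)
  also have "\<dots> = (\<Prod>i<m. g i ^ m) * g m ^ m"
    by (cases m) (simp_all add: prod.distrib mult_ac)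
  finally show ?case by simp
qed simp

text \<open>Both sides are polynomials of degree at most \<open>m\<close> in \<open>u\<close> that agree at the \<open>m + 1\<close> points \<open>u = s k\<close>.\<close>

lemma vandermonde_expand:
  fixes s :: "nat \<Rightarrow> 'a::idom"
  assumes inj: "inj_on s {..<Suc m}"
  shows "(\<Prod>(i, j)\<in>index_pairs (Suc m). s j - s i) =
    (\<Sum>p<Suc m. (-1) ^ p * (\<Prod>i<m. s (skip p i) - u) *
       (\<Prod>(i, j)\<in>index_pairs m. s (skip p j) - s (skip p i)))"
proof -
  define V where "V p = (\<Prod>(i, j)\<in>index_pairs m. s (skip p j) - s (skip p i))" for p
  define P where "P = (\<Sum>p<Suc m. smult ((-1) ^ p * V p) (\<Prod>i<m. [:s (skip p i), -1:]))"
  let ?V = "\<Prod>(i, j)\<in>index_pairs (Suc m). s j - s i"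
  have evP: "poly P v = (\<Sum>p<Suc m. (-1) ^ p * V p * (\<Prod>i<m. s (skip p i) - v))" for v
    by (simp add: P_def poly_sum poly_prod)
  have degP: "degree P \<le> m"
    unfolding P_def
  proof (rule degree_sum_le)
    fix p
    have "degree (\<Prod>i<m. [:s (skip p i), -1:]) \<le> (\<Sum>i<m. degree [:s (skip p i), -1:])"
      by (rule degree_prod_sum_le[of "{..<m}" "\<lambda>i. [:s (skip p i), -1:]", unfolded comp_def]) simp
    then show "degree (smult ((-1) ^ p * V p) (\<Prod>i<m. [:s (skip p i), -1:])) \<le> m"
      by (auto intro: order.trans[OF degree_smult_le])
  qed simp
  have "P = [:?V:]"
  proof (rule poly_eqI_degree[of "s ` {..<Suc m}"])
    fix x assume "x \<in> s ` {..<Suc m}"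
    then obtain k where k: "k < Suc m" "x = s k" by auto
    have "poly P x = (\<Sum>p<Suc m. if p = k then (-1) ^ k * V k * (\<Prod>i<m. s (skip k i) - s k) else 0)"
      unfolding evP
    proof (rule sum.cong[OF refl], goal_cases)
      case (1 p)
      show ?case
      proof (cases "p = k")
        case False
        \<comment> \<open>Index \<open>k\<close> survives the deletion of \<open>p\<close>, and its
          factor vanishes at the point \<open>s k\<close>.\<close>
        then have "k \<in> skip p ` {..<m}" using k 1 skip_image[of p m] by auto
        then obtain i where "i < m" "skip p i = k" by auto
        then have "(\<Prod>i<m. s (skip p i) - s k) = 0"
          by (intro prod_zero) auto
        then show ?thesis using False k by simp
      qed (use k in auto)
    qed
    also have "\<dots> = (-1) ^ k * V k * (\<Prod>i<m. s (skip k i) - s k)"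
      using k by simp
    also have "(\<Prod>i<m. s (skip k i) - s k) = (\<Prod>i\<in>{..<Suc m} - {k}. s i - s k)"
      by (rule prod_skip[OF k(1)])
    also have "{..<Suc m} - {k} = {..<k} \<union> {k<..<Suc m}" using k by auto
    also have "(\<Prod>i\<in>{..<k} \<union> {k<..<Suc m}. s i - s k) =
        (\<Prod>i<k. s i - s k) * (\<Prod>i\<in>{k<..<Suc m}. s i - s k)"
      by (rule prod.union_disjoint) auto
    \<comment> \<open>Reversing the \<open>k\<close> differences with smaller indices gives a sign
      that cancels the sign of the expansion.\<close>
    also have "(\<Prod>i<k. s i - s k) = (-1) ^ k * (\<Prod>i<k. s k - s i)"
      using prod.distrib[of "\<lambda>_. -1" "\<lambda>i. s k - s i" "{..<k}"] by simp
    also have "(-1) ^ k * V k * ((-1) ^ k * (\<Prod>i<k. s k - s i) * (\<Prod>i\<in>{k<..<Suc m}. s i - s k)) =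
        V k * ((\<Prod>i<k. s k - s i) * (\<Prod>i\<in>{k<..<Suc m}. s i - s k)) * ((-1) ^ k * (-1) ^ k)"
      by (simp only: mult_ac)
    also have "(-1) ^ k * (-1) ^ k = (1::'a)"
      by (simp flip: power_mult_distrib)
    also have "V k * ((\<Prod>i<k. s k - s i) * (\<Prod>i\<in>{k<..<Suc m}. s i - s k)) * 1 = ?V"
      using prod_pairs_skip[OF k(1), of "\<lambda>i j. s j - s i"] by (simp add: V_def)
    finally show "poly P x = poly [:?V:] x" by simp
  qed (use degP card_image[OF inj] in auto)
  then have "?V = poly P u" by simp
  then show ?thesis
    unfolding evP by (simp add: V_def mult_ac)
qed

section \<open>Laurent polynomials\<close>

lemma var_powi_0 [simp]: "var_powi i 0 = 1"
  by (simp add: var_powi_def)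

lemma var_powi_add: "var_powi i (a + b) = var_powi i a * var_powi i b"
  by (simp add: var_powi_def mult_single single_add)

lemma var_mult_inverse [simp]: "var i * var_powi i (-1) = 1" "var_powi i (-1) * var i = 1"
  by (simp_all flip: var_powi_add)

lemma var_powi_power: "var_powi i k ^ n = var_powi i (int n * k)"
  by (induction n) (simp_all add: algebra_simps flip: var_powi_add)

lemma constant_term_add: "constant_term (p + q) = constant_term p + constant_term q"
  by (simp add: constant_term_def lookup_add)

lemma constant_term_uminus: "constant_term (- p) = - constant_term p"
  by (simp add: constant_term_def)

lemma constant_term_diff: "constant_term (p - q) = constant_term p - constant_term q"
  by (simp add: constant_term_def lookup_minus)

lemma constant_term_sum: "constant_term (sum f A) = (\<Sum>x\<in>A. constant_term (f x))"
  by (simp add: constant_term_def lookup_sum)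

lemma constant_term_1 [simp]: "constant_term 1 = 1"
  by (simp add: constant_term_def)

lemma constant_term_of_int_mult: "constant_term (of_int c * p) = c * constant_term p"
proof -
  have "constant_term (of_nat n * p) = int n * constant_term p" for n
    by (induction n) (simp_all add: algebra_simps constant_term_add constant_term_def[of 0])
  then show ?thesis
    by (cases c rule: int_cases2) (simp_all add: constant_term_uminus)
qed

subsection \<open>Renaming variables\<close>

text \<open>Exponent vectors and Laurent polynomials are elements of free abelian groups, on the
  variables and on the monomials respectively. Both renamings are therefore additive extensions of
  maps on generators.\<close>

definition rename_exponents :: "(nat \<Rightarrow> nat) \<Rightarrow> (nat \<Rightarrow>\<^sub>0 int) \<Rightarrow> (nat \<Rightarrow>\<^sub>0 int)" where
  "rename_exponents \<pi> = frag_extend (frag_of \<circ> \<pi>)"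

definition rename :: "(nat \<Rightarrow> nat) \<Rightarrow> laurent \<Rightarrow> laurent" where
  "rename \<pi> = frag_extend (\<lambda>m. frag_of (rename_exponents \<pi> m))"

lemma rename_add: "rename \<pi> (p + q) = rename \<pi> p + rename \<pi> q"
  by (simp add: rename_def frag_extend_add)

lemma rename_diff: "rename \<pi> (p - q) = rename \<pi> p - rename \<pi> q"
  by (simp add: rename_def frag_extend_diff)

text \<open>Both sides are additive in \<open>p\<close> and in \<open>q\<close>, so it suffices to
  compare them on monomials, whose exponent vectors add.\<close>

lemma rename_mult: "rename \<pi> (p * q) = rename \<pi> p * rename \<pi> q"
proof -
  have mono: "rename \<pi> (frag_of m * q) = rename \<pi> (frag_of m) * rename \<pi> q" for m and q :: laurent
    using subset_UNIV[of "Poly_Mapping.keys q"]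
    by (induction q rule: frag_induction)
      (simp_all add: rename_def rename_exponents_def mult_single frag_extend_add frag_extend_diff
        right_diff_distrib)
  show ?thesis
    using subset_UNIV[of "Poly_Mapping.keys p"]
    by (induction p rule: frag_induction)
      (simp_all add: mono rename_diff left_diff_distrib, simp add: rename_def)
qed

lemma rename_var_powi [simp]: "rename \<pi> (var_powi i k) = var_powi (\<pi> i) k"
proof -
  have single_cmul: "Poly_Mapping.single j k = frag_cmul k (frag_of j)" for j :: nat
    by (rule poly_mapping_eqI) (simp add: lookup_single)
  show ?thesis
    by (simp add: rename_def rename_exponents_def var_powi_def single_cmul frag_extend_cmul)
qed

lemma rename_1 [simp]: "rename \<pi> 1 = 1"
  using rename_var_powi[of \<pi> 0 0] by simp

lemma rename_prod: "rename \<pi> (prod f A) = (\<Prod>x\<in>A. rename \<pi> (f x))"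
  by (induction A rule: infinite_finite_induct) (simp_all add: rename_mult)

lemma rename_power: "rename \<pi> (p ^ n) = rename \<pi> p ^ n"
  by (induction n) (simp_all add: rename_mult)

text \<open>Renaming along \<open>inv \<pi>\<close> undoes the renaming of exponents, so no nonzero
  exponent vector is sent to zero.\<close>

lemma constant_term_rename:
  assumes "inj \<pi>"
  shows "constant_term (rename \<pi> p) = constant_term p"
proof -
  have id: "rename_exponents (inv \<pi>) (rename_exponents \<pi> m) = m" for m
    using frag_extend_compose[of "frag_of \<circ> inv \<pi>" \<pi> m] frag_expansion[of m] assms
    by (simp add: rename_exponents_def comp_assoc[symmetric] comp_def)
  have zero: "rename_exponents \<pi> m = 0 \<longleftrightarrow> m = 0" for m
    using id[of m] by (auto simp: rename_exponents_def)
  show ?thesis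
    using subset_UNIV[of "Poly_Mapping.keys p"]
    by (induction p rule: frag_induction)
      (auto simp: rename_diff constant_term_diff, auto simp: rename_def constant_term_def zero)
qed

subsection \<open>Bounds on exponents\<close>

text \<open>With \<open>e = 1\<close> the exponents of variable \<open>i\<close> are at least \<open>c\<close>, with \<open>e = -1\<close> at most \<open>-c\<close>.\<close>

definition expo_ge :: "int \<Rightarrow> nat \<Rightarrow> int \<Rightarrow> laurent \<Rightarrow> bool" where
  "expo_ge e i c p \<longleftrightarrow> (\<forall>m\<in>Poly_Mapping.keys p. c \<le> e * Poly_Mapping.lookup m i)"

lemma expo_ge_add: "expo_ge e i c p \<Longrightarrow> expo_ge e i c q \<Longrightarrow> expo_ge e i c (p + q)"
  using keys_add[of p q] by (auto simp: expo_ge_def)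

lemma expo_ge_diff: "expo_ge e i c p \<Longrightarrow> expo_ge e i c q \<Longrightarrow> expo_ge e i c (p - q)"
  using keys_diff[of p q] by (auto simp: expo_ge_def)

lemma expo_ge_uminus: "expo_ge e i c p \<Longrightarrow> expo_ge e i c (- p)"
  by (auto simp: expo_ge_def)

lemma expo_ge_mult: "expo_ge e i c p \<Longrightarrow> expo_ge e i d q \<Longrightarrow> expo_ge e i (c + d) (p * q)"
  using keys_mult[of p q] by (fastforce simp: expo_ge_def lookup_add distrib_left)

lemma expo_ge_mult0: "expo_ge e i 0 p \<Longrightarrow> expo_ge e i 0 q \<Longrightarrow> expo_ge e i 0 (p * q)"
  using expo_ge_mult[of e i 0 p 0 q] by simp

lemma expo_ge_mono: "expo_ge e i c p \<Longrightarrow> d \<le> c \<Longrightarrow> expo_ge e i d p"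
  by (force simp: expo_ge_def)

lemma expo_ge_1: "expo_ge e i 0 1"
  by (auto simp: expo_ge_def)

lemma expo_ge_of_int: "expo_ge e i 0 (of_int c)"
  using keys_single[of "0 :: nat \<Rightarrow>\<^sub>0 int" c] by (auto simp: expo_ge_def simp flip: single_of_int split: if_splits)

lemma expo_ge_var_powi: "c \<le> e * k \<Longrightarrow> expo_ge e i c (var_powi i k)"
  by (auto simp: expo_ge_def var_powi_def)

lemma expo_ge_var_powi': "j \<noteq> i \<Longrightarrow> expo_ge e i 0 (var_powi j k)"
  by (auto simp: expo_ge_def var_powi_def lookup_single)

lemma expo_ge_prod: "(\<And>x. x \<in> A \<Longrightarrow> expo_ge e i 0 (f x)) \<Longrightarrow> expo_ge e i 0 (prod f A)"
  by (induction A rule: infinite_finite_induct) (auto intro: expo_ge_1 expo_ge_mult0)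

lemma expo_ge_power: "expo_ge e i 0 p \<Longrightarrow> expo_ge e i 0 (p ^ n)"
  by (induction n) (auto intro: expo_ge_1 expo_ge_mult0)

lemmas expo_ge_intros =
  expo_ge_add expo_ge_diff expo_ge_uminus expo_ge_mult0 expo_ge_1 expo_ge_var_powi
  expo_ge_var_powi' expo_ge_prod expo_ge_power

lemma constant_term_expo_ge: "expo_ge e i 1 p \<Longrightarrow> constant_term p = 0"
  by (force simp: expo_ge_def constant_term_def in_keys_iff)

text \<open>Equality at \<open>x\<^sub>i = \<infinity>\<close>, for Laurent polynomials without positive powers of \<open>x\<^sub>i\<close>.\<close>

definition eq_at_inf :: "nat \<Rightarrow> laurent \<Rightarrow> laurent \<Rightarrow> bool" where
  "eq_at_inf i p q \<longleftrightarrow> expo_ge (-1) i 0 q \<and> expo_ge (-1) i 1 (p - q)"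

lemma eq_at_inf_refl: "expo_ge (-1) i 0 p \<Longrightarrow> eq_at_inf i p p"
  by (simp add: eq_at_inf_def expo_ge_def)

lemma eq_at_inf_mult:
  assumes "eq_at_inf i p q" "eq_at_inf i p' q'"
  shows "eq_at_inf i (p * p') (q * q')"
proof -
  \<comment> \<open>\<open>p'\<close> is the sum of \<open>q'\<close> and a difference with only
    negative powers, so it has no positive powers either.\<close>
  have p: "expo_ge (-1) i 0 p'"
    using expo_ge_add[of "-1" i 0 q' "p' - q'"] assms(2) expo_ge_mono[of "-1" i 1 "p' - q'" 0]
    by (simp add: eq_at_inf_def)
  have "p * p' - q * q' = (p - q) * p' + q * (p' - q')"
    by (simp add: algebra_simps)
  moreover have "expo_ge (-1) i 1 ((p - q) * p')"
    using expo_ge_mult[of "-1" i 1 "p - q" 0 p'] p assms by (simp add: eq_at_inf_def)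
  moreover have "expo_ge (-1) i 1 (q * (p' - q'))"
    using expo_ge_mult[of "-1" i 0 q 1 "p' - q'"] assms by (simp add: eq_at_inf_def)
  ultimately show ?thesis
    using assms by (auto simp: eq_at_inf_def intro: expo_ge_add expo_ge_mult0)
qed

lemma eq_at_inf_prod: "(\<And>x. x \<in> A \<Longrightarrow> eq_at_inf i (f x) (g x)) \<Longrightarrow> eq_at_inf i (prod f A) (prod g A)"
  by (induction A rule: infinite_finite_induct)
    (auto intro: eq_at_inf_refl expo_ge_1 eq_at_inf_mult)

lemma constant_term_eq_at_inf: "eq_at_inf i p q \<Longrightarrow> constant_term p = constant_term q"
  using constant_term_expo_ge[of "-1" i "p - q"] by (simp add: eq_at_inf_def constant_term_diff)

subsection \<open>The constant term functional\<close>

text \<open>A weight is a Laurent polynomial in one variable, given as a function of the variable index.\<close>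

definition natural :: "(nat \<Rightarrow> laurent) \<Rightarrow> bool" where
  "natural f \<longleftrightarrow> (\<forall>\<pi> i. rename \<pi> (f i) = f (\<pi> i))"

text \<open>Taking both signs of \<open>e\<close>, the bound says that no variable other than
  \<open>i\<close> occurs in \<open>f i\<close>.\<close>

definition univariate :: "(nat \<Rightarrow> laurent) \<Rightarrow> bool" where
  "univariate f \<longleftrightarrow> natural f \<and> (\<forall>e i j. j \<noteq> i \<longrightarrow> expo_ge e j 0 (f i))"

definition kern :: "nat \<Rightarrow> nat \<Rightarrow> laurent" where
  "kern i j = (var j - var i) * (1 + var i + var i * var j)"

text \<open>The map \<open>v\<close> names the variable at each position, so that one variable can
  be deleted while the others keep their names. The power \<open>1 - int (length fs)\<close> cancels
  the product of all \<open>x_i x_j\<close> over pairs, which \<open>integrand_factor\<close>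
  extracts from the kernels.\<close>

definition integrand :: "(nat \<Rightarrow> nat) \<Rightarrow> (nat \<Rightarrow> laurent) list \<Rightarrow> laurent" where
  "integrand v fs =
     (\<Prod>i<length fs. (fs ! i) (v i) * var_powi (v i) (1 - int (length fs))) *
     (\<Prod>(i, j)\<in>index_pairs (length fs). kern (v i) (v j))"

definition Phi :: "(nat \<Rightarrow> laurent) list \<Rightarrow> int" where
  "Phi fs = constant_term (integrand id fs)"

lemma Phi_Nil [simp]: "Phi [] = 1"
  by (simp add: Phi_def integrand_def)

lemma rename_kern: "rename \<pi> (kern i j) = kern (\<pi> i) (\<pi> j)"
  by (simp add: kern_def rename_mult rename_add rename_diff)

lemma rename_integrand:
  assumes "\<forall>f\<in>set fs. natural f"
  shows "rename \<pi> (integrand v fs) = integrand (\<pi> \<circ> v) fs"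
  using assms by (auto simp: integrand_def rename_mult rename_prod natural_def rename_kern case_prod_beta)

lemma Phi_rename:
  assumes "\<forall>f\<in>set fs. natural f" "inj \<pi>"
  shows "constant_term (integrand \<pi> fs) = Phi fs"
  using rename_integrand[OF assms(1), of \<pi> id] constant_term_rename[OF assms(2)]
  by (metis Phi_def comp_id)

lemma integrand_factor:
  assumes "\<And>i j. i < j \<Longrightarrow> j < length fs \<Longrightarrow> kern (v i) (v j) = var (v i) * var (v j) * F i j"
  shows "integrand v fs = (\<Prod>i<length fs. (fs ! i) (v i)) * (\<Prod>(i, j)\<in>index_pairs (length fs). F i j)"
proof -
  let ?m = "length fs"
  have "(\<Prod>(i, j)\<in>index_pairs ?m. kern (v i) (v j)) =
      (\<Prod>(i, j)\<in>index_pairs ?m. (var (v i) * var (v j)) * F i j)"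
    by (rule prod.cong) (auto simp: assms)
  also have "\<dots> = (\<Prod>(i, j)\<in>index_pairs ?m. var (v i) * var (v j)) * (\<Prod>(i, j)\<in>index_pairs ?m. F i j)"
    by (simp add: case_prod_beta prod.distrib)
  also have "\<dots> = (\<Prod>i<?m. var (v i) ^ (?m - 1)) * (\<Prod>(i, j)\<in>index_pairs ?m. F i j)"
    by (simp only: prod_pairs_mult[of "\<lambda>i. var (v i)"])
  finally have "integrand v fs = (\<Prod>i<?m. (fs ! i) (v i) * (var_powi (v i) (1 - int ?m) * var (v i) ^ (?m - 1))) *
      (\<Prod>(i, j)\<in>index_pairs ?m. F i j)"
    by (simp add: integrand_def prod.distrib mult_ac)
  also have "(\<Prod>i<?m. (fs ! i) (v i) * (var_powi (v i) (1 - int ?m) * var (v i) ^ (?m - 1))) =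
      (\<Prod>i<?m. (fs ! i) (v i))"
    by (rule prod.cong) (auto simp: var_powi_power simp flip: var_powi_add)
  finally show ?thesis .
qed

lemma Phi_add:
  "Phi (A @ (\<lambda>i. f i + g i) # B) = Phi (A @ f # B) + Phi (A @ g # B)"
proof -
  define a where "a = length A"
  define m where "m = Suc (length A + length B)"
  define R where "R = (\<Prod>i\<in>{..<m} - {a}. ((A @ f # B) ! i) i * var_powi i (1 - int m))"
  have split: "(\<Prod>i<m. ((A @ h # B) ! i) i * var_powi i (1 - int m)) =
      h a * var_powi a (1 - int m) * R" for h
  proof -
    have "(\<Prod>i<m. ((A @ h # B) ! i) i * var_powi i (1 - int m)) =
       h a * var_powi a (1 - int m) * (\<Prod>i\<in>{..<m} - {a}. ((A @ h # B) ! i) i * var_powi i (1 - int m))"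
      by (subst prod.remove[of _ a]) (auto simp: m_def a_def)
    also have "(\<Prod>i\<in>{..<m} - {a}. ((A @ h # B) ! i) i * var_powi i (1 - int m)) = R"
      unfolding R_def by (rule prod.cong) (auto simp: nth_append a_def nth_Cons split: nat.splits)
    finally show ?thesis .
  qed
  have len: "length (A @ h # B) = m" for h :: "nat \<Rightarrow> laurent" by (simp add: m_def)
  show ?thesis
    unfolding Phi_def integrand_def id_apply len split
    by (simp add: algebra_simps constant_term_add)
qed

section \<open>Exchange of neighbouring weights, and expansion along the column of ones\<close>

lemma constant_term_sign_mult: "constant_term ((-1) ^ k * p) = (-1) ^ k * constant_term p"
  using constant_term_of_int_mult[of "(-1) ^ k" p] by simp

text \<open>The difference of the two integrands is antisymmetric in two neighbouring variables, because
  \<open>(1 + x)(1 + y) - x = 1 + y + x y\<close> complements the factor \<open>1 + x + x y\<close> of the kernel.\<close>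

lemma Phi_exchange:
  assumes nat: "\<forall>f\<in>set A \<union> set B. natural f" "natural g"
  shows "Phi (A @ (\<lambda>i. (1 + var i) * g i) # (\<lambda>i. (1 + var i) * g i) # B) =
    Phi (A @ (\<lambda>i. var i * g i) # g # B)"
proof -
  define a where "a = length A"
  define m where "m = Suc (Suc (length A + length B))"
  define \<tau> where "\<tau> i = (if i = a then Suc a else if i = Suc a then a else i)" for i
  define X where "X i = var_powi i (1 - int m)" for i
  define R where "R = (\<Prod>i\<in>{..<m} - {a, Suc a}. ((A @ g # g # B) ! i) i * X i)"
  define P where "P = index_pairs m - {(a, Suc a)}"
  define K where "K = (\<Prod>(i, j)\<in>P. kern i j)"
  have a: "a < m" "Suc a < m" by (simp_all add: a_def m_def)
  have \<tau>\<tau>: "\<tau> (\<tau> i) = i" for i by (simp add: \<tau>_def)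
  have inj: "inj \<tau>" by (metis \<tau>\<tau> injI)
  have split: "integrand id (A @ h # h' # B) = h a * h' (Suc a) * (X a * X (Suc a) * kern a (Suc a) * R * K)" for h h'
  proof -
    have len: "length (A @ h # h' # B) = m" by (simp add: m_def)
    have K: "(\<Prod>(i, j)\<in>index_pairs m. kern i j) = kern a (Suc a) * K"
      unfolding K_def P_def using a by (subst prod.remove[of _ "(a, Suc a)"]) auto
    have "(\<Prod>i<m. ((A @ h # h' # B) ! i) i * X i) =
       (\<Prod>i\<in>{a, Suc a}. ((A @ h # h' # B) ! i) i * X i) * (\<Prod>i\<in>{..<m} - {a, Suc a}. ((A @ h # h' # B) ! i) i * X i)"
      using a by (subst prod.subset_diff[of "{a, Suc a}"]) (auto simp: mult_ac)
    also have "(\<Prod>i\<in>{..<m} - {a, Suc a}. ((A @ h # h' # B) ! i) i * X i) = R"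
      unfolding R_def by (rule prod.cong) (auto simp: nth_append a_def nth_Cons split: nat.splits)
    also have "(\<Prod>i\<in>{a, Suc a}. ((A @ h # h' # B) ! i) i * X i) = h a * X a * (h' (Suc a) * X (Suc a))"
      by (simp add: a_def nth_append)
    finally show ?thesis
      unfolding integrand_def len id_apply X_def[symmetric] K by (simp add: mult_ac)
  qed
  have rR: "rename \<tau> R = R"
  proof -
    have "rename \<tau> (((A @ g # g # B) ! i) i * X i) = ((A @ g # g # B) ! i) i * X i"
      if "i \<in> {..<m} - {a, Suc a}" for i
    proof -
      have "natural ((A @ g # g # B) ! i)"
        using nth_mem[of i "A @ g # g # B"] nat that by (auto simp: m_def)
      moreover have "\<tau> i = i" using that by (simp add: \<tau>_def)
      ultimately show ?thesis by (simp add: rename_mult natural_def X_def)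
    qed
    then show ?thesis by (auto simp: R_def rename_prod intro!: prod.cong)
  qed
  \<comment> \<open>Swapping two neighbours preserves the order inside every pair except the removed
    pair \<open>(a, Suc a)\<close>.\<close>
  have rK: "rename \<tau> K = K"
  proof -
    have "K = (\<Prod>(i, j)\<in>P. kern (\<tau> i) (\<tau> j))"
      unfolding K_def
    proof (rule prod.reindex_bij_witness[of _ "\<lambda>(i, j). (\<tau> i, \<tau> j)" "\<lambda>(i, j). (\<tau> i, \<tau> j)"])
      fix x assume "x \<in> P"
      then show "(case x of (i, j) \<Rightarrow> (\<tau> i, \<tau> j)) \<in> P"
        using a by (auto simp: P_def \<tau>_def split: if_splits)
      then show "(case x of (i, j) \<Rightarrow> (\<tau> i, \<tau> j)) \<in> P" .
    qed (auto simp: \<tau>\<tau>)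
    then show ?thesis by (simp add: K_def rename_prod rename_kern case_prod_beta \<tau>\<tau>)
  qed
  \<comment> \<open>In the last factor of \<open>T\<close>, with \<open>x\<close>, \<open>y\<close>
    the two variables, \<open>(1 + y + x y) (1 + x + x y)\<close> is symmetric and
    \<open>y - x\<close> changes sign.\<close>
  define T where "T = g a * g (Suc a) * (X a * X (Suc a)) *
    ((1 + var (Suc a) + var a * var (Suc a)) * kern a (Suc a))"
  have rT: "rename \<tau> T = - T"
  proof -
    have "rename \<tau> (g a) = g (Suc a)" "rename \<tau> (g (Suc a)) = g a"
      using nat by (simp_all add: natural_def \<tau>_def)
    then have "rename \<tau> T = g (Suc a) * g a * (X (Suc a) * X a) *
      ((1 + var a + var (Suc a) * var a) * kern (Suc a) a)"
      by (simp add: T_def rename_mult rename_add rename_kern X_def) (simp add: \<tau>_def)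
    also have "\<dots> = - T"
      by (simp add: T_def kern_def) algebra
    finally show ?thesis .
  qed
  have "integrand id (A @ (\<lambda>i. (1 + var i) * g i) # (\<lambda>i. (1 + var i) * g i) # B) -
      integrand id (A @ (\<lambda>i. var i * g i) # g # B) = T * R * K"
    unfolding split T_def by algebra
  then have "Phi (A @ (\<lambda>i. (1 + var i) * g i) # (\<lambda>i. (1 + var i) * g i) # B) -
      Phi (A @ (\<lambda>i. var i * g i) # g # B) = constant_term (T * R * K)"
    by (simp only: Phi_def flip: constant_term_diff)
  moreover have "constant_term (T * R * K) = - constant_term (T * R * K)"
    using constant_term_rename[OF inj, of "T * R * K"]
    by (simp add: rename_mult rT rR rK constant_term_uminus)
  ultimately show ?thesis by simp
qed

text \<open>The weights in \<open>hs\<close> have only positive powers, and \<open>c q\<close> is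
  the value at infinity of weight \<open>q\<close> of \<open>gs\<close>. When variable
  \<open>q\<close> of \<open>gs\<close> is deleted, the others receive the factor
  \<open>1 + t\<close>, which is \<open>- 1/x\<close> on \<open>hs\<close> and \<open>1 + x\<close>
  on \<open>gs\<close>. The kernels between the deleted variable and the later ones contribute the
  additional factors \<open>1 + 1/x\<close>.\<close>

lemma Phi_expand:
  assumes hs: "\<forall>f\<in>set hs. univariate f \<and> (\<forall>i. expo_ge 1 i 1 (f i))"
    and gs: "\<forall>q<length gs. univariate (gs ! q) \<and> (\<forall>i. expo_ge (-1) i 1 ((gs ! q) i - of_int (c q)))"
    and ne: "hs @ gs \<noteq> []"
  shows "Phi (hs @ gs) = (\<Sum>q<length gs. (-1) ^ q * c q *
    Phi (map (\<lambda>f i. var_powi i (-1) * f i) hs @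
         map (\<lambda>f i. (1 + var i) * f i) (take q gs) @
         map (\<lambda>f i. (1 + var i) * (1 + var_powi i (-1)) * f i) (drop (Suc q) gs)))"
proof -
  define fs where "fs = hs @ gs"
  define a where "a = length hs"
  define y where "y i = var_powi i (-1)" for i
  obtain m where m: "length fs = Suc m"
    using ne by (cases "length fs") (auto simp: fs_def)
  have am: "Suc m = a + length gs" using m by (simp add: fs_def a_def)
  define t where "t i = (if i < a then - 1 - y i else var i)" for i
  \<comment> \<open>The cofactor of \<open>x_i x_j (t_j - t_i)\<close> in the kernel, for
    \<open>i < j\<close>. The cases are that both indices, only \<open>i\<close>, or neither belong
    to \<open>hs\<close>.\<close>
  define \<rho> where "\<rho> i j = (if j < a then 1 + var i + var i * var j
      else if i < a then 1 - var i * y j else 1 + y j + y i * y j)" for i j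
  have xy: "var i * y i = 1" for i by (simp add: y_def)
  have kern_t: "kern i j = var i * var j * ((t j - t i) * \<rho> i j)" if "i < j" for i j
  proof -
    consider "j < a" | "i < a" "\<not> j < a" | "\<not> i < a" "\<not> j < a" using that by linarith
    then show ?thesis
    proof cases
      case 1
      have "t j - t i = y i - y j" using 1 that by (simp add: t_def)
      then show ?thesis
        using 1 xy[of i] xy[of j] unfolding kern_def \<rho>_def if_P[OF 1] by algebra
    next
      case 2
      have "t j - t i = var j + 1 + y i" using 2 that by (simp add: t_def)
      then show ?thesis
        using xy[of i] xy[of j] unfolding kern_def \<rho>_def if_P[OF 2(1)] if_not_P[OF 2(2)] by algebra
    next
      case 3
      have "t j - t i = var j - var i" using 3 by (simp add: t_def)
      then show ?thesis
        using xy[of i] xy[of j] unfolding kern_def \<rho>_def if_not_P[OF 3(1)] if_not_P[OF 3(2)] by algebra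
    qed
  qed
  have fs_univ: "univariate (fs ! i)" if "i < Suc m" for i
    using that hs gs nth_mem[of i fs] m by (auto simp: fs_def in_set_conv_nth)
  \<comment> \<open>\<open>vandermonde_expand\<close> asks for distinct points. The monomial
    \<open>k\<close> below occurs in \<open>t i\<close> but not in \<open>t j\<close>.\<close>
  have inj_t: "inj_on t {..<Suc m}"
  proof (rule inj_onI, rule ccontr)
    fix i j assume ij: "t i = t j" "i \<noteq> j"
    define k where "k = Poly_Mapping.single i (if i < a then -1 else 1 :: int)"
    have "k \<noteq> 0" by (auto simp: k_def simp flip: keys_eq_empty)
    moreover have "k \<noteq> Poly_Mapping.single j b" for b
    proof
      assume "k = Poly_Mapping.single j b"
      then have "Poly_Mapping.lookup k i = Poly_Mapping.lookup (Poly_Mapping.single j b) i" by simp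
      then show False using ij(2) by (simp add: k_def lookup_single split: if_splits)
    qed
    ultimately have "Poly_Mapping.lookup (t j) k = 0"
      by (simp add: t_def y_def var_powi_def lookup_minus lookup_one lookup_single)
    moreover have "Poly_Mapping.lookup (t i) k \<noteq> 0"
      using \<open>k \<noteq> 0\<close>
      by (auto simp: t_def y_def var_powi_def lookup_minus lookup_one lookup_single k_def when_def)
    ultimately show False using ij by simp
  qed
  define W where "W p = (\<Prod>i<m. t (skip p i) + 1) *
      (\<Prod>(i, j)\<in>index_pairs m. t (skip p j) - t (skip p i))" for p
  define Z where "Z p = (\<Prod>i<Suc m. (fs ! i) i) * W p * (\<Prod>(i, j)\<in>index_pairs (Suc m). \<rho> i j)" for p
  have "integrand id fs = (\<Prod>i<Suc m. (fs ! i) i) * (\<Prod>(i, j)\<in>index_pairs (Suc m). (t j - t i) * \<rho> i j)"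
    using integrand_factor[of fs id "\<lambda>i j. (t j - t i) * \<rho> i j"] kern_t m by simp
  also have "\<dots> = (\<Prod>i<Suc m. (fs ! i) i) * (\<Prod>(i, j)\<in>index_pairs (Suc m). t j - t i) *
      (\<Prod>(i, j)\<in>index_pairs (Suc m). \<rho> i j)"
    by (simp add: case_prod_beta prod.distrib mult.assoc)
  \<comment> \<open>The differences are those of the points \<open>1 + t\<close>, which is why the
    expansion is taken at \<open>u = -1\<close>.\<close>
  also have "(\<Prod>(i, j)\<in>index_pairs (Suc m). t j - t i) = (\<Sum>p<Suc m. (-1) ^ p * W p)"
    using vandermonde_expand[OF inj_t, of "-1"] by (simp add: W_def mult.assoc)
  finally have "integrand id fs = (\<Sum>p<Suc m. (-1) ^ p * Z p)"
    by (simp add: id_def Z_def sum_distrib_left sum_distrib_right mult_ac del: sum.lessThan_Suc prod.lessThan_Suc)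
  then have "Phi fs = (\<Sum>p<Suc m. (-1) ^ p * constant_term (Z p))"
    by (simp add: Phi_def constant_term_sum constant_term_sign_mult del: sum.lessThan_Suc)
  also have "\<dots> = (\<Sum>p\<in>(+) a ` {..<length gs}. (-1) ^ p * constant_term (Z p))"
  proof (rule sum.mono_neutral_right)
    show "\<forall>p\<in>{..<Suc m} - (+) a ` {..<length gs}. (-1) ^ p * constant_term (Z p) = 0"
    proof
      \<comment> \<open>Suppose the entry 1 is taken from a variable \<open>p\<close> of
        \<open>hs\<close>. Its weight has only positive powers, \<open>W p\<close> no longer
        contains \<open>t p\<close>, and \<open>\<rho>\<close> has no negative power of it. All
        exponents of this variable are thus positive, and the constant term is 0.\<close>
      fix p assume p: "p \<in> {..<Suc m} - (+) a ` {..<length gs}"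
      have pa: "p < a"
      proof (rule ccontr)
        assume "\<not> p < a"
        then have "p = a + (p - a)" "p - a < length gs" using p am by auto
        then show False using p by blast
      qed
      have "fs ! p \<in> set hs" using pa by (simp add: fs_def a_def nth_append)
      then have fp: "expo_ge 1 p 1 ((fs ! p) p)" using hs by auto
      have fi: "expo_ge 1 p 0 ((fs ! i) i)" if "i < Suc m" "i \<noteq> p" for i
        using fs_univ[OF that(1)] that(2) by (auto simp: univariate_def)
      have ti: "expo_ge 1 p 0 (t i)" if "i \<noteq> p" for i
        using that by (auto simp: t_def y_def intro!: expo_ge_intros)
      have rij: "expo_ge 1 p 0 (\<rho> i j)" if "i < j" for i j
      proof -
        have v: "expo_ge 1 p 0 (var k)" for k by (cases "k = p") (auto intro: expo_ge_intros)
        have y: "expo_ge 1 p 0 (y k)" if "\<not> k < a" for k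
          using that pa by (auto simp: y_def intro!: expo_ge_intros)
        show ?thesis unfolding \<rho>_def using that by (auto intro!: expo_ge_add expo_ge_diff expo_ge_mult0 expo_ge_1 v y)
      qed
      have "expo_ge 1 p (1 + 0) ((fs ! p) p * ((\<Prod>i\<in>{..<Suc m} - {p}. (fs ! i) i) *
          (W p * (\<Prod>(i, j)\<in>index_pairs (Suc m). \<rho> i j))))"
        unfolding W_def
        by (intro expo_ge_mult fp expo_ge_mult0 expo_ge_prod) (auto intro!: fi ti rij expo_ge_add expo_ge_diff expo_ge_1)
      moreover have "Z p = (fs ! p) p * ((\<Prod>i\<in>{..<Suc m} - {p}. (fs ! i) i) *
          (W p * (\<Prod>(i, j)\<in>index_pairs (Suc m). \<rho> i j)))"
        unfolding Z_def using p by (subst prod.remove[of _ p]) (auto simp: mult_ac)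
      ultimately have "constant_term (Z p) = 0"
        by (intro constant_term_expo_ge[of 1 p]) simp
      then show "(-1) ^ p * constant_term (Z p) = 0" by simp
    qed
  qed (use am in auto)
  also have "\<dots> = (\<Sum>q<length gs. (-1) ^ (a + q) * constant_term (Z (a + q)))"
    by (subst sum.reindex) auto
  also have "\<dots> = (\<Sum>q<length gs. (-1) ^ q * c q *
    Phi (map (\<lambda>f i. var_powi i (-1) * f i) hs @
         map (\<lambda>f i. (1 + var i) * f i) (take q gs) @
         map (\<lambda>f i. (1 + var i) * (1 + var_powi i (-1)) * f i) (drop (Suc q) gs)))"
  proof (rule sum.cong[OF refl])
    fix q assume q: "q \<in> {..<length gs}"
    define p where "p = a + q"
    have p: "p < Suc m" "a \<le> p" using q am by (auto simp: p_def)
    define new where "new = map (\<lambda>f i. var_powi i (-1) * f i) hs @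
         map (\<lambda>f i. (1 + var i) * f i) (take q gs) @
         map (\<lambda>f i. (1 + var i) * (1 + var_powi i (-1)) * f i) (drop (Suc q) gs)"
    have len: "length new = m" using q am by (auto simp: new_def a_def)
    have new_nth: "(new ! i) k = (if i < a then y k else if i < p then 1 + var k else (1 + var k) * (1 + y k)) *
        (fs ! skip p i) k" if "i < m" for i k
    proof -
      consider "i < a" | "a \<le> i" "i < p" | "p \<le> i" by linarith
      then show ?thesis
      proof cases
        case 1
        then show ?thesis using p by (simp add: new_def a_def nth_append fs_def skip_def y_def)
      next
        case 2
        then show ?thesis using q by (auto simp: new_def a_def nth_append fs_def skip_def p_def)
      next
        case 3
        then have *: "Suc i - length hs = Suc (i - length hs)" by (simp add: p_def a_def)
        show ?thesis using q 3 that am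
          by (auto simp: new_def a_def nth_append fs_def skip_def p_def y_def *)
      qed
    qed
    have new_natural: "\<forall>f\<in>set new. natural f"
    proof -
      have "natural f" if "f \<in> set hs \<union> set gs" for f
        using that hs gs by (auto simp: univariate_def in_set_conv_nth[of _ gs])
      then show ?thesis
        by (auto simp: new_def natural_def rename_mult rename_add dest!: in_set_takeD in_set_dropD)
    qed
    \<comment> \<open>At infinity in variable \<open>p\<close>, the factors
      \<open>\<rho> i p\<close> become 1 and the factors \<open>\<rho> p j\<close> become
      \<open>1 + y j\<close>; \<open>Y\<close> collects the latter. Variable \<open>p\<close> does
      not occur in \<open>Rest\<close>.\<close>
    define Y where "Y = (\<Prod>j\<in>{p<..<Suc m}. 1 + y j)"
    define Rest where "Rest = (\<Prod>i<m. (fs ! skip p i) (skip p i)) * W p *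
       (\<Prod>(i, j)\<in>index_pairs m. \<rho> (skip p i) (skip p j))"
    have Z: "Z p = (fs ! p) p * ((\<Prod>i<p. \<rho> i p) * (\<Prod>j\<in>{p<..<Suc m}. \<rho> p j)) * Rest"
    proof -
      have "(\<Prod>i<Suc m. (fs ! i) i) = (fs ! p) p * (\<Prod>i<m. (fs ! skip p i) (skip p i))"
        using p prod_skip[OF p(1), of "\<lambda>i. (fs ! i) i"] by (subst prod.remove[of _ p]) auto
      then show ?thesis
        unfolding Z_def Rest_def prod_pairs_skip[OF p(1), of \<rho>] by (simp only: mult_ac)
    qed
    have "eq_at_inf p (Z p) (of_int (c q) * (1 * Y) * Rest)"
      unfolding Z
    proof (intro eq_at_inf_mult)
      have "gs ! q = fs ! p" by (simp add: fs_def p_def a_def)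
      then show "eq_at_inf p ((fs ! p) p) (of_int (c q))"
        using gs q by (auto simp: eq_at_inf_def expo_ge_of_int)
      have yp: "expo_ge (-1) p 1 (y p)" by (simp add: y_def expo_ge_var_powi)
      have vi: "expo_ge (-1) p 0 (var i)" "expo_ge (-1) p 0 (y i)" if "i \<noteq> p" for i
        using that by (auto simp: y_def intro: expo_ge_intros)
      have "eq_at_inf p (\<Prod>i<p. \<rho> i p) (\<Prod>i<p. 1)"
      proof (rule eq_at_inf_prod)
        fix i assume i: "i \<in> {..<p}"
        have "\<rho> i p - 1 = (if i < a then - var i else 1 + y i) * y p"
          using i p by (simp add: \<rho>_def algebra_simps)
        moreover have "expo_ge (-1) p (0 + 1) ((if i < a then - var i else 1 + y i) * y p)"
          using i by (intro expo_ge_mult yp) (auto intro!: expo_ge_add expo_ge_uminus expo_ge_1 vi)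
        ultimately show "eq_at_inf p (\<rho> i p) 1"
          by (simp add: eq_at_inf_def expo_ge_1)
      qed
      then show "eq_at_inf p (\<Prod>i<p. \<rho> i p) 1" by simp
      show "eq_at_inf p (\<Prod>j\<in>{p<..<Suc m}. \<rho> p j) Y"
        unfolding Y_def
      proof (rule eq_at_inf_prod)
        fix j assume j: "j \<in> {p<..<Suc m}"
        have "\<rho> p j - (1 + y j) = y j * y p"
          using j p by (simp add: \<rho>_def algebra_simps)
        moreover have "expo_ge (-1) p (0 + 1) (y j * y p)"
          using j by (intro expo_ge_mult yp vi) auto
        ultimately show "eq_at_inf p (\<rho> p j) (1 + y j)"
          using j vi[of j] by (auto simp: eq_at_inf_def intro!: expo_ge_add expo_ge_1)
      qed
      show "eq_at_inf p Rest Rest"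
      proof (rule eq_at_inf_refl)
        have fi: "expo_ge (-1) p 0 ((fs ! skip p i) (skip p i))" if "i < m" for i
        proof -
          have "skip p i < Suc m" using that by (simp add: skip_def)
          then show ?thesis using fs_univ[of "skip p i"] skip_neq[of p i] unfolding univariate_def by metis
        qed
        have ti: "expo_ge (-1) p 0 (t (skip p i))" for i
          unfolding t_def by (auto intro!: expo_ge_diff expo_ge_uminus expo_ge_1 vi)
        have rij: "expo_ge (-1) p 0 (\<rho> (skip p i) (skip p j))" for i j
          unfolding \<rho>_def by (auto intro!: expo_ge_add expo_ge_diff expo_ge_mult0 expo_ge_1 vi)
        show "expo_ge (-1) p 0 Rest"
          unfolding Rest_def W_def
          by (intro expo_ge_mult0 expo_ge_prod) (auto intro!: fi ti rij expo_ge_add expo_ge_diff expo_ge_1)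
      qed
    qed
    then have "constant_term (Z p) = constant_term (of_int (c q) * (Y * Rest))"
      using constant_term_eq_at_inf by (simp add: mult.assoc)
    then have CT: "constant_term (Z p) = c q * constant_term (Y * Rest)"
      by (simp add: constant_term_of_int_mult)
    have Yskip: "Y = (\<Prod>i<m. if i < p then 1 else 1 + y (skip p i))"
    proof -
      have "(\<Prod>i<m. if skip p i < p then 1 else 1 + y (skip p i)) =
          (\<Prod>j\<in>{..<Suc m} - {p}. if j < p then 1 else 1 + y j)"
        by (rule prod_skip[OF p(1), of "\<lambda>j. if j < p then 1 else 1 + y j"])
      also have "(\<Prod>j\<in>{..<Suc m} - {p}. if j < p then 1 else 1 + y j) = Y"
        unfolding Y_def using p by (intro prod.mono_neutral_cong_right) auto
      finally have "(\<Prod>i<m. if skip p i < p then 1 else 1 + y (skip p i)) = Y" .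
      moreover have "skip p i < p \<longleftrightarrow> i < p" for i by (simp add: skip_def)
      ultimately show ?thesis by simp
    qed
    \<comment> \<open>On \<open>hs\<close> the factor \<open>t + 1\<close> equals
      \<open>- y\<close>, so its \<open>a\<close> variables produce this sign. It cancels against
      the part \<open>(-1) ^ a\<close> of the sign at position \<open>p = a + q\<close>.\<close>
    have sgn: "(\<Prod>i<m. if i < a then - 1 else 1) = (-1 :: laurent) ^ a"
    proof -
      have "(\<Prod>i<m. if i < a then - 1 else 1) = (\<Prod>i<a. (-1 :: laurent))"
        if "a \<le> m" using that by (intro prod.mono_neutral_cong_right) auto
      then show ?thesis using p by simp
    qed
    have "Y * (\<Prod>i<m. t (skip p i) + 1) * (\<Prod>i<m. (fs ! skip p i) (skip p i)) =
       (\<Prod>i<m. (if i < a then - 1 else 1) * (new ! i) (skip p i))"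
      unfolding Yskip prod.distrib[symmetric]
    proof (rule prod.cong[OF refl])
      fix i assume i: "i \<in> {..<m}"
      show "(if i < p then 1 else 1 + y (skip p i)) * (t (skip p i) + 1) * (fs ! skip p i) (skip p i) =
        (if i < a then - 1 else 1) * (new ! i) (skip p i)"
        using p i by (auto simp: new_nth t_def skip_def mult_ac)
    qed
    also have "\<dots> = (-1) ^ a * (\<Prod>i<m. (new ! i) (skip p i))"
      by (simp add: prod.distrib sgn)
    finally have *: "Y * (\<Prod>i<m. t (skip p i) + 1) * (\<Prod>i<m. (fs ! skip p i) (skip p i)) =
      (-1) ^ a * (\<Prod>i<m. (new ! i) (skip p i))" .
    \<comment> \<open>What remains is the factored integrand of the \<open>m\<close> new weights in
      the variables other than \<open>p\<close>. The injective renaming \<open>skip p\<close> leaves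
      its constant term unchanged.\<close>
    have "integrand (skip p) new = (\<Prod>i<m. (new ! i) (skip p i)) *
        (\<Prod>(i, j)\<in>index_pairs m. (t (skip p j) - t (skip p i)) * \<rho> (skip p i) (skip p j))"
      using integrand_factor[of new "skip p" "\<lambda>i j. (t (skip p j) - t (skip p i)) * \<rho> (skip p i) (skip p j)"]
        kern_t len by simp
    also have "\<dots> = (\<Prod>i<m. (new ! i) (skip p i)) * ((\<Prod>(i, j)\<in>index_pairs m. t (skip p j) - t (skip p i)) *
        (\<Prod>(i, j)\<in>index_pairs m. \<rho> (skip p i) (skip p j)))"
      by (simp add: case_prod_beta prod.distrib)
    finally have "(-1) ^ a * integrand (skip p) new = Y * Rest"
      unfolding Rest_def W_def using * by (simp add: mult.assoc[symmetric]) (simp add: mult_ac)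
    then have "constant_term (Y * Rest) = (-1) ^ a * Phi new"
      using Phi_rename[OF new_natural inj_skip[of p]]
      by (metis constant_term_sign_mult)
    then have "(-1) ^ (a + q) * constant_term (Z (a + q)) = ((-1) ^ a * (-1) ^ a) * ((-1) ^ q * c q * Phi new)"
      using CT unfolding p_def by (simp add: power_add mult_ac)
    also have "(-1) ^ a * (-1) ^ a = (1 :: int)"
      by (simp flip: power_mult_distrib)
    finally show "(-1) ^ (a + q) * constant_term (Z (a + q)) = (-1) ^ q * c q *
       Phi (map (\<lambda>f i. var_powi i (-1) * f i) hs @
         map (\<lambda>f i. (1 + var i) * f i) (take q gs) @
         map (\<lambda>f i. (1 + var i) * (1 + var_powi i (-1)) * f i) (drop (Suc q) gs))"
      by (simp add: new_def)
  qed
  finally show ?thesis by (simp add: fs_def)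
qed

section \<open>Interlacing rows\<close>

lemma sorted_list_of_set_union:
  fixes A B :: "'a::linorder set"
  assumes "finite A" "finite B" "\<And>a b. a \<in> A \<Longrightarrow> b \<in> B \<Longrightarrow> a < b"
  shows "sorted_list_of_set (A \<union> B) = sorted_list_of_set A @ sorted_list_of_set B"
proof (rule sorted_distinct_set_unique)
  show "sorted (sorted_list_of_set A @ sorted_list_of_set B)"
    using assms by (auto simp: sorted_append intro: less_imp_le)
  show "distinct (sorted_list_of_set A @ sorted_list_of_set B)"
    using assms by fastforce
qed (use assms in simp_all)

lemma sorted_list_of_set_plus:
  fixes A :: "int set"
  assumes "finite A"
  shows "sorted_list_of_set ((+) d ` A) = map ((+) d) (sorted_list_of_set A)"
proof (rule sorted_distinct_set_unique)
  show "sorted (map ((+) d) (sorted_list_of_set A))"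
    by (simp add: sorted_map)
qed (use assms in \<open>simp_all add: distinct_map\<close>)

text \<open>Here \<open>K\<close> and \<open>M\<close> are the sets of columns with partial sum 1 (from the top) after and before a
  row, so that \<open>of_bool (k \<in> K) - of_bool (k \<in> M)\<close> is the entry of that row in column \<open>k\<close>.\<close>

definition row_psum :: "int set \<Rightarrow> int set \<Rightarrow> nat \<Rightarrow> int" where
  "row_psum K M d = (\<Sum>k\<in>{0..<int d}. of_bool (k \<in> K) - of_bool (k \<in> M))"

text \<open>The parameter \<open>s\<close> is the state of the row after columns
  \<open>0, ..., c - 1\<close>. Keeping it variable allows the row to be built column by column from
  the left.\<close>

definition scan :: "int set \<Rightarrow> nat \<Rightarrow> int \<Rightarrow> int set set" where
  "scan K c s = {M. M \<subseteq> {0..<int c} \<and> (\<forall>d\<le>c. row_psum K M d \<in> {0, 1}) \<and> row_psum K M c = s}"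

lemma finite_scan [simp]: "finite (scan K c s)"
  by (rule finite_subset[of _ "Pow {0..<int c}"]) (auto simp: scan_def)

lemma scan_finite_mem: "M \<in> scan K c s \<Longrightarrow> finite M"
  by (rule finite_subset[of _ "{0..<int c}"]) (auto simp: scan_def)

lemma row_psum_Suc: "row_psum K M (Suc c) = row_psum K M c + of_bool (int c \<in> K) - of_bool (int c \<in> M)"
proof -
  have "{0..<int (Suc c)} = insert (int c) {0..<int c}" by auto
  then show ?thesis by (simp add: row_psum_def)
qed

lemma row_psum_cong:
  assumes "M \<inter> {0..<int d} = M' \<inter> {0..<int d}"
  shows "row_psum K M d = row_psum K M' d"
  unfolding row_psum_def
proof (rule sum.cong[OF refl])
  fix k assume "k \<in> {0..<int d}"
  then have "k \<in> M \<longleftrightarrow> k \<in> M'" using assms by blast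
  then show "of_bool (k \<in> K) - of_bool (k \<in> M) = (of_bool (k \<in> K) - of_bool (k \<in> M') :: int)"
    by simp
qed

lemma scan_0: "scan K 0 s = (if s = 0 then {{}} else {})"
  by (auto simp: scan_def row_psum_def)

lemma scan_empty: "s \<notin> {0, 1} \<Longrightarrow> scan K c s = {}"
  by (auto simp: scan_def)

text \<open>The final state and the membership of column \<open>c\<close> in \<open>K\<close> and
  \<open>M\<close> determine the state before column \<open>c\<close>; the two parts of the union
  are the two choices for \<open>M\<close>.\<close>

lemma scan_Suc:
  assumes "s \<in> {0, 1}"
  shows "scan K (Suc c) s = scan K c (s - of_bool (int c \<in> K)) \<union>
    insert (int c) ` scan K c (s - of_bool (int c \<in> K) + 1)"
proof (intro set_eqI iffI)
  fix M assume M: "M \<in> scan K (Suc c) s"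
  define N where "N = M - {int c}"
  have N: "row_psum K N d = row_psum K M d" if "d \<le> c" for d
    using that by (intro row_psum_cong) (auto simp: N_def)
  have sub: "N \<subseteq> {0..<int c}" using M by (auto simp: scan_def N_def)
  have "row_psum K N c = s - of_bool (int c \<in> K) + of_bool (int c \<in> M)"
  proof -
    have "row_psum K M (Suc c) = s" using M by (simp add: scan_def)
    then show ?thesis unfolding N[OF order.refl] row_psum_Suc by linarith
  qed
  moreover have "\<forall>d\<le>c. row_psum K N d \<in> {0, 1}" using M N unfolding scan_def by auto
  ultimately have "N \<in> scan K c (s - of_bool (int c \<in> K) + of_bool (int c \<in> M))"
    using sub by (simp add: scan_def)
  moreover have "M = insert (int c) N" if "int c \<in> M" using that by (auto simp: N_def)
  moreover have "M = N" if "int c \<notin> M" using that by (auto simp: N_def)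
  ultimately show "M \<in> scan K c (s - of_bool (int c \<in> K)) \<union>
    insert (int c) ` scan K c (s - of_bool (int c \<in> K) + 1)"
    by (cases "int c \<in> M") auto
next
  fix M assume "M \<in> scan K c (s - of_bool (int c \<in> K)) \<union>
    insert (int c) ` scan K c (s - of_bool (int c \<in> K) + 1)"
  then have "\<exists>N b. N \<in> scan K c (s - of_bool (int c \<in> K) + of_bool b) \<and>
      M = (if b then insert (int c) N else N)"
  proof
    assume "M \<in> scan K c (s - of_bool (int c \<in> K))"
    then show ?thesis by (intro exI[of _ M] exI[of _ False]) simp
  next
    assume "M \<in> insert (int c) ` scan K c (s - of_bool (int c \<in> K) + 1)"
    then obtain N where "N \<in> scan K c (s - of_bool (int c \<in> K) + 1)" "M = insert (int c) N" by auto
    then show ?thesis by (intro exI[of _ N] exI[of _ True]) simp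
  qed
  then obtain N b where N: "N \<in> scan K c (s - of_bool (int c \<in> K) + of_bool b)"
    "M = (if b then insert (int c) N else N)" by blast
  have eq: "row_psum K M d = row_psum K N d" if "d \<le> c" for d
    using that N by (intro row_psum_cong) auto
  have sub: "N \<subseteq> {0..<int c}" using N by (auto simp: scan_def)
  then have "of_bool (int c \<in> M) = (of_bool b :: int)" using N(2) by auto
  then have fin: "row_psum K M (Suc c) = s"
  proof -
    have "row_psum K N c = s - of_bool (int c \<in> K) + of_bool b" using N(1) by (simp add: scan_def)
    then show ?thesis unfolding row_psum_Suc eq[OF order.refl] \<open>of_bool (int c \<in> M) = of_bool b\<close> by linarith
  qed
  have "row_psum K M d \<in> {0, 1}" if "d \<le> Suc c" for d
  proof (cases "d = Suc c")
    case True
    then show ?thesis using fin assms by simp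
  next
    case False
    then have "d \<le> c" using that by simp
    moreover have "\<forall>d\<le>c. row_psum K N d \<in> {0, 1}" using N(1) by (simp add: scan_def)
    ultimately show ?thesis using eq by metis
  qed
  moreover have "M \<subseteq> {0..<int (Suc c)}" using sub N(2) by auto
  ultimately show "M \<in> scan K (Suc c) s"
    using fin unfolding scan_def by blast
qed

lemma sum_scan_Suc:
  assumes "s \<in> {0, 1}"
  shows "(\<Sum>M\<in>scan K (Suc c) s. G (sorted_list_of_set M)) =
    (\<Sum>M\<in>scan K c (s - of_bool (int c \<in> K)). G (sorted_list_of_set M)) +
    (\<Sum>M\<in>scan K c (s - of_bool (int c \<in> K) + 1). G (sorted_list_of_set M @ [int c]))"
proof -
  let ?s = "s - of_bool (int c \<in> K)"
  have notin: "int c \<notin> M" if "M \<in> scan K c s'" for M s' using that by (auto simp: scan_def)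
  have inj: "inj_on (insert (int c)) (scan K c (?s + 1))"
    by (rule inj_onI) (metis insert_ident notin)
  have "(\<Sum>M\<in>scan K (Suc c) s. G (sorted_list_of_set M)) =
    (\<Sum>M\<in>scan K c ?s. G (sorted_list_of_set M)) +
    (\<Sum>M\<in>insert (int c) ` scan K c (?s + 1). G (sorted_list_of_set M))"
    unfolding scan_Suc[OF assms] by (rule sum.union_disjoint) (use notin in auto)
  also have "(\<Sum>M\<in>insert (int c) ` scan K c (?s + 1). G (sorted_list_of_set M)) =
    (\<Sum>M\<in>scan K c (?s + 1). G (sorted_list_of_set M @ [int c]))"
    unfolding sum.reindex[OF inj] comp_def
  proof (rule sum.cong[OF refl])
    fix M assume M: "M \<in> scan K c (?s + 1)"
    then have "sorted_list_of_set (M \<union> {int c}) = sorted_list_of_set M @ sorted_list_of_set {int c}"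
      by (intro sorted_list_of_set_union) (auto simp: scan_def intro: finite_subset)
    then show "G (sorted_list_of_set (insert (int c) M)) = G (sorted_list_of_set M @ [int c])" by simp
  qed
  finally show ?thesis .
qed

section \<open>Middle column weights, their indefinite sums and the summation over interlacing
  rows\<close>

definition shift_var :: "nat \<Rightarrow> laurent" where
  "shift_var i = 1 + var_powi i (-1)"

text \<open>For columns \<open>k\<close> of the bottom row this is the weight of the shifted column
  once the row is removed, see \<open>wt_mid\<close>.\<close>

definition colw :: "int \<Rightarrow> nat \<Rightarrow> laurent" where
  "colw k i = shift_var i ^ nat (k + 1)"

text \<open>\<open>sumw k\<close> is \<open>x E\<^bsup>k+1\<^esup>\<close>, an indefinite sum of the column weights \<open>E\<^bsup>k+1\<^esup>\<close>, see \<open>sumw_step\<close>.\<close>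

definition sumw :: "int \<Rightarrow> nat \<Rightarrow> laurent" where
  "sumw k i = var i * shift_var i ^ nat (k + 1)"

lemma var_shift_var: "var i * shift_var i = 1 + var i"
  by (simp add: shift_var_def distrib_left)

lemma natural_shift_var: "rename \<pi> (shift_var i) = shift_var (\<pi> i)"
  by (simp add: shift_var_def rename_add)

lemma natural_colw: "natural (colw k)"
  by (simp add: natural_def colw_def rename_power natural_shift_var)

lemma natural_sumw: "natural (sumw k)"
  by (simp add: natural_def sumw_def rename_mult rename_power natural_shift_var)

text \<open>With \<open>E = shift_var\<close>, \<open>x E = x + 1\<close> gives
  \<open>x E^(k+2) - x E^(k+1) = E^(k+1)\<close>.\<close>

lemma sumw_step: "0 \<le> k \<Longrightarrow> sumw (k + 1) = (\<lambda>i. sumw k i + colw k i)"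
proof
  fix i assume k: "0 \<le> k"
  have "nat (k + 1 + 1) = Suc (nat (k + 1))" using k by simp
  then have "sumw (k + 1) i = (var i * shift_var i) * shift_var i ^ nat (k + 1)"
    by (simp add: sumw_def mult_ac)
  also have "\<dots> = colw k i + sumw k i"
    by (simp only: var_shift_var sumw_def colw_def distrib_right mult_1)
  finally show "sumw (k + 1) i = sumw k i + colw k i"
    by (simp only: add.commute)
qed

lemma Phi_exchange_sumw:
  assumes "\<forall>f\<in>set A \<union> set B. natural f" "0 \<le> k"
  shows "Phi (A @ sumw (k + 1) # sumw (k + 1) # B) = Phi (A @ sumw k # colw k # B)"
proof -
  have "sumw (k + 1) = (\<lambda>i. (1 + var i) * colw k i)"
    using sumw_step[OF assms(2)] by (auto simp: sumw_def colw_def algebra_simps)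
  moreover have "sumw k = (\<lambda>i. var i * colw k i)" by (auto simp: sumw_def colw_def)
  ultimately show ?thesis
    using Phi_exchange[OF assms(1) natural_colw, of k] by (simp add: eta_contract_eq)
qed

text \<open>The shape that \<open>Phi_expand\<close> produces for the columns \<open>ks\<close> of
  the bottom row: one column is omitted, and by \<open>wt_sumw\<close> the earlier ones get
  \<open>sumw k\<close> and the later ones \<open>sumw (k + 1)\<close>.\<close>

definition omit_sum :: "(nat \<Rightarrow> laurent) list \<Rightarrow> int list \<Rightarrow> (nat \<Rightarrow> laurent) list \<Rightarrow> int" where
  "omit_sum A ks B = (\<Sum>p<length ks. (-1) ^ p *
     Phi (A @ map sumw (take p ks) @ map (\<lambda>k. sumw (k + 1)) (drop (Suc p) ks) @ B))"

lemma omit_sum_snoc: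
  "omit_sum A (ks @ [c]) B = omit_sum A ks (sumw (c + 1) # B) + (-1) ^ length ks * Phi (A @ map sumw ks @ B)"
  by (simp add: omit_sum_def)

lemma omit_sum_add:
  "omit_sum A ks ((\<lambda>i. f i + g i) # B) = omit_sum A ks (f # B) + omit_sum A ks (g # B)"
  unfolding omit_sum_def sum.distrib[symmetric]
proof (rule sum.cong[OF refl])
  fix p
  show "(-1) ^ p * Phi (A @ map sumw (take p ks) @ map (\<lambda>k. sumw (k + 1)) (drop (Suc p) ks) @ (\<lambda>i. f i + g i) # B) =
    (-1) ^ p * Phi (A @ map sumw (take p ks) @ map (\<lambda>k. sumw (k + 1)) (drop (Suc p) ks) @ f # B) +
    (-1) ^ p * Phi (A @ map sumw (take p ks) @ map (\<lambda>k. sumw (k + 1)) (drop (Suc p) ks) @ g # B)"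
    using Phi_add[of "A @ map sumw (take p ks) @ map (\<lambda>k. sumw (k + 1)) (drop (Suc p) ks)" f g B]
    by (simp add: algebra_simps)
qed

lemma omit_sum_exchange:
  assumes "\<forall>f\<in>set A \<union> set B. natural f" "0 \<le> k"
  shows "omit_sum A ks (sumw (k + 1) # sumw (k + 1) # B) = omit_sum A ks (sumw k # colw k # B)"
  unfolding omit_sum_def
proof (rule sum.cong[OF refl])
  fix p
  have "\<forall>f\<in>set (A @ map sumw (take p ks) @ map (\<lambda>k. sumw (k + 1)) (drop (Suc p) ks)) \<union> set B. natural f"
    using assms natural_sumw by auto
  from Phi_exchange_sumw[OF this assms(2)]
  show "(-1) ^ p * Phi (A @ map sumw (take p ks) @ map (\<lambda>k. sumw (k + 1)) (drop (Suc p) ks) @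
       sumw (k + 1) # sumw (k + 1) # B) =
    (-1) ^ p * Phi (A @ map sumw (take p ks) @ map (\<lambda>k. sumw (k + 1)) (drop (Suc p) ks) @
       sumw k # colw k # B)" by simp
qed

text \<open>Both states are treated in one induction on \<open>c\<close>, with \<open>B\<close>
  arbitrary because putting column \<open>c\<close> into \<open>M\<close> moves
  \<open>colw c\<close> to the front of \<open>B\<close>. By \<open>omit_sum_snoc\<close>, the value
  for state 0 is \<open>omit_sum\<close> for the list \<open>ks\<close> extended by
  \<open>int c - 1\<close>. Sums over a column choice telescope through
  \<open>sumw_step\<close>.\<close>

lemma sum_scan:
  fixes K :: "int set" and c :: nat
  defines "ks \<equiv> sorted_list_of_set (K \<inter> {0..<int c})"
  assumes nat: "\<forall>f\<in>set A \<union> set B. natural f"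
  shows "(\<Sum>M\<in>scan K c 1. Phi (A @ map colw (sorted_list_of_set M) @ B)) = omit_sum A ks B"
    and "(\<Sum>M\<in>scan K c 0. Phi (A @ map colw (sorted_list_of_set M) @ B)) =
      omit_sum A ks (sumw (int c) # B) + (-1) ^ length ks * Phi (A @ map sumw ks @ B)"
  using nat unfolding ks_def
proof (induction c arbitrary: B)
  case 0
  {
    case 1
    show ?case by (simp add: scan_0 omit_sum_def)
  next
    case 2
    show ?case by (simp add: scan_0 omit_sum_def)
  }
next
  case (Suc c)
  let ?ks = "sorted_list_of_set (K \<inter> {0..<int c})"
  have nat_cons: "\<forall>f\<in>set A \<union> set (colw (int c) # B). natural f" if "\<forall>f\<in>set A \<union> set B. natural f" for B
    using that natural_colw by auto
  have int_Suc: "int (Suc c) = int c + 1" by simp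
  have ks_in: "sorted_list_of_set (K \<inter> {0..<int c + 1}) = ?ks @ [int c]" if "int c \<in> K"
  proof -
    have "K \<inter> {0..<int c + 1} = (K \<inter> {0..<int c}) \<union> {int c}" using that by auto
    then show ?thesis using sorted_list_of_set_union[of "K \<inter> {0..<int c}" "{int c}"] by simp
  qed
  have ks_out: "K \<inter> {0..<int c + 1} = K \<inter> {0..<int c}" if "int c \<notin> K"
  proof -
    have "{0..<int c + 1} = insert (int c) {0..<int c}" by auto
    then show ?thesis using that by auto
  qed
  have step: "omit_sum A ks (sumw (int c + 1) # B) = omit_sum A ks (sumw (int c) # B) + omit_sum A ks (colw (int c) # B)" for ks B
    using omit_sum_add[of A ks "sumw (int c)" "colw (int c)" B] sumw_step[of "int c"] by simp
  define G where "G B s = (\<Sum>M\<in>scan K c s. Phi (A @ map colw (sorted_list_of_set M) @ B))" for B s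
  have G: "(\<Sum>M\<in>scan K (Suc c) s. Phi (A @ map colw (sorted_list_of_set M) @ B)) =
      G B (s - of_bool (int c \<in> K)) + G (colw (int c) # B) (s - of_bool (int c \<in> K) + 1)"
    if "s \<in> {0, 1}" for B s
    using sum_scan_Suc[OF that, where G = "\<lambda>M. Phi (A @ map colw M @ B)"] by (simp add: G_def)
  \<comment> \<open>The states -1 and 2 are impossible. This forces the choice for \<open>M\<close>
    in state 1 if \<open>c\<close> is outside \<open>K\<close>, and in state 0 if \<open>c\<close>
    is in \<open>K\<close>.\<close>
  have G_out: "G B (-1) = 0" "G B 2 = 0" for B
    using scan_empty[of 2 K c] scan_empty[of "-1" K c] by (simp_all add: G_def)
  note IH = Suc.IH[folded G_def]
  {
    case 1
    note n = 1 and n' = nat_cons[OF 1]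
    show ?case
    proof (cases "int c \<in> K")
      case True
      have "(\<Sum>M\<in>scan K (Suc c) 1. Phi (A @ map colw (sorted_list_of_set M) @ B)) = G B 0 + G (colw (int c) # B) 1"
        using G[of 1 B] True by simp
      then show ?thesis
        unfolding int_Suc ks_in[OF True] omit_sum_snoc step IH(1)[OF n'] IH(2)[OF n] by simp
    next
      case False
      have "(\<Sum>M\<in>scan K (Suc c) 1. Phi (A @ map colw (sorted_list_of_set M) @ B)) = G B 1"
        using G[of 1 B] False G_out by simp
      then show ?thesis
        unfolding int_Suc ks_out[OF False] IH(1)[OF n] .
    qed
  next
    case 2
    note n = 2 and n' = nat_cons[OF 2]
    show ?case
    proof (cases "int c \<in> K")
      case True
      have add: "Phi (A @ map sumw ?ks @ sumw (int c + 1) # B) =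
          Phi (A @ map sumw ?ks @ sumw (int c) # B) + Phi (A @ map sumw ?ks @ colw (int c) # B)"
        using Phi_add[of "A @ map sumw ?ks" "sumw (int c)" "colw (int c)" B] sumw_step[of "int c"] by simp
      \<comment> \<open>This is the one case that needs the antisymmetry: \<open>c\<close> lies in
        \<open>K\<close> and, since the row ends in state 0, also in \<open>M\<close>.\<close>
      have exch: "omit_sum A ?ks (sumw (int c + 1) # sumw (int c + 1) # B) = omit_sum A ?ks (sumw (int c) # colw (int c) # B)"
        by (rule omit_sum_exchange[OF n]) simp
      have "(\<Sum>M\<in>scan K (Suc c) 0. Phi (A @ map colw (sorted_list_of_set M) @ B)) = G (colw (int c) # B) 0"
        using G[of 0 B] True G_out by simp
      then show ?thesis
        unfolding int_Suc ks_in[OF True] omit_sum_snoc IH(2)[OF n'] exch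
        by (simp add: add.commute[of 1 "int c"] add distrib_left)
    next
      case False
      have "(\<Sum>M\<in>scan K (Suc c) 0. Phi (A @ map colw (sorted_list_of_set M) @ B)) = G B 0 + G (colw (int c) # B) 1"
        using G[of 0 B] False by simp
      then show ?thesis
        unfolding int_Suc ks_out[OF False] step IH(1)[OF n'] IH(2)[OF n] by simp
    qed
  }
qed

subsection \<open>Weights of columns\<close>

text \<open>The middle formula also extends the neighbouring ones: it gives 1 at
  \<open>k = 0\<close> and \<open>E^l\<close> at \<open>k = l\<close>. Columns strictly between need
  weights too, because the recursion reaches arrays with column sum 1 there.\<close>

definition wt :: "nat \<Rightarrow> int \<Rightarrow> nat \<Rightarrow> laurent" where
  "wt l k i = (if k < 0 then var_powi i (- k)
     else if k \<le> int l then shift_var i ^ nat k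
     else var_powi i (int l - k) * shift_var i ^ l)"

lemma univariate_wt: "univariate (wt l k)"
proof -
  have "expo_ge e j 0 (shift_var i)" if "j \<noteq> i" for e i j
    using that by (auto simp: shift_var_def intro!: expo_ge_intros)
  then show ?thesis
    by (auto simp: univariate_def natural_def wt_def rename_mult rename_power natural_shift_var
        intro!: expo_ge_mult0 expo_ge_power expo_ge_var_powi')
qed

lemma expo_ge_wt_neg: "k < 0 \<Longrightarrow> expo_ge 1 i 1 (wt l k i)"
  by (simp add: wt_def expo_ge_var_powi)

text \<open>At infinity \<open>E\<close> becomes 1, whereas the power \<open>x^(l-k)\<close> with
  \<open>k > l\<close> becomes 0.\<close>

lemma expo_ge_wt_nonneg:
  assumes "0 \<le> k"
  shows "expo_ge (-1) i 1 (wt l k i - of_int (of_bool (k \<le> int l)))"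
proof -
  have "eq_at_inf i (shift_var i) 1"
    by (simp add: eq_at_inf_def shift_var_def expo_ge_1 expo_ge_var_powi)
  then have pow: "eq_at_inf i (shift_var i ^ n) 1" for n
    by (induction n) (auto intro: eq_at_inf_refl expo_ge_1 dest: eq_at_inf_mult)
  show ?thesis
  proof (cases "k \<le> int l")
    case True
    then show ?thesis using pow[of "nat k"] assms by (simp add: wt_def eq_at_inf_def)
  next
    case False
    have "expo_ge (-1) i 0 (shift_var i ^ l)"
      using expo_ge_add[of "-1" i 0 1 "shift_var i ^ l - 1"] pow[of l] expo_ge_1
        expo_ge_mono[of "-1" i 1 "shift_var i ^ l - 1" 0] by (simp add: eq_at_inf_def)
    then have "expo_ge (-1) i (1 + 0) (var_powi i (int l - k) * shift_var i ^ l)"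
      using False by (intro expo_ge_mult expo_ge_var_powi) auto
    then show ?thesis using False assms by (simp add: wt_def)
  qed
qed

text \<open>Here and in \<open>wt_shift_right\<close>, the factors from \<open>Phi_expand\<close>
  turn a weight for \<open>l\<close> into the weight of the same column after removal of the bottom
  row, where \<open>l\<close> grows by 2 and columns move by 1.\<close>

lemma wt_shift_neg: "k < 0 \<Longrightarrow> wt (Suc (Suc l)) (1 + k) = (\<lambda>i. var_powi i (-1) * wt l k i)"
proof
  fix i assume "k < 0"
  then show "wt (Suc (Suc l)) (1 + k) i = var_powi i (-1) * wt l k i"
    by (cases "k = -1") (auto simp: wt_def simp flip: var_powi_add)
qed

lemma wt_mid: "0 \<le> k \<Longrightarrow> k \<le> int l \<Longrightarrow> wt (Suc (Suc l)) (1 + k) = colw k"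
  by (auto simp: wt_def colw_def add.commute[of k])

text \<open>For columns inside the bottom row the same factors give indefinite sums instead, because
  \<open>(1 + x) E^k = x E^(k+1)\<close>.\<close>

lemma wt_sumw:
  assumes "0 \<le> k" "k \<le> int l"
  shows "(\<lambda>i. (1 + var i) * wt l k i) = sumw k"
    and "(\<lambda>i. (1 + var i) * (1 + var_powi i (-1)) * wt l k i) = sumw (k + 1)"
proof -
  have s: "nat (k + 1) = Suc (nat k)" "nat (2 + k) = Suc (Suc (nat k))" using assms by auto
  show "(\<lambda>i. (1 + var i) * wt l k i) = sumw k"
    using assms by (intro ext) (simp add: wt_def sumw_def s mult_ac flip: var_shift_var)
  show "(\<lambda>i. (1 + var i) * (1 + var_powi i (-1)) * wt l k i) = sumw (k + 1)"
    unfolding shift_var_def[symmetric]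
    using assms by (intro ext) (simp add: wt_def sumw_def s mult_ac flip: var_shift_var)
qed

lemma wt_shift_right:
  assumes "int l < k"
  shows "wt (Suc (Suc l)) (1 + k) = (\<lambda>i. (1 + var i) * (1 + var_powi i (-1)) * wt l k i)"
proof
  fix i
  have "(1 + var i) * (1 + var_powi i (-1)) * wt l k i =
      var_powi i (1 + (int l - k)) * shift_var i ^ (Suc (Suc l))"
    unfolding shift_var_def[symmetric] var_powi_add
    using assms by (simp add: wt_def mult_ac flip: var_shift_var)
  also have "\<dots> = wt (Suc (Suc l)) (1 + k) i"
    using assms by (cases "k = int l + 1") (auto simp: wt_def nat_add_distrib algebra_simps)
  finally show "wt (Suc (Suc l)) (1 + k) i = (1 + var i) * (1 + var_powi i (-1)) * wt l k i" by simp
qed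

text \<open>The bottom row occupies the columns \<open>0, \<dots>, l\<close>, so outside of them nothing changes.\<close>

definition row_preds :: "nat \<Rightarrow> int set \<Rightarrow> int set set" where
  "row_preds l K = (\<lambda>M. K \<inter> {..<0} \<union> M \<union> K \<inter> {int l<..}) ` scan K (Suc l) 1"

text \<open>In \<open>Phi_expand\<close>, the columns left of the bottom row form \<open>hs\<close>,
  and those in it or right of it form \<open>gs\<close>. Columns on the right have value 0 at
  infinity, so only omissions inside the row survive. \<open>sum_scan\<close> turns their
  alternating sum into the sum over interlacing rows.\<close>

lemma Phi_wt_rec:
  assumes fin: "finite K" and ne: "K \<noteq> {}"
  shows "Phi (map (wt l) (sorted_list_of_set K)) =
    (\<Sum>K'\<in>row_preds l K. Phi (map (wt (Suc (Suc l))) (sorted_list_of_set ((+) 1 ` K'))))"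
proof -
  define Kl where "Kl = sorted_list_of_set (K \<inter> {..<0})"
  define Km where "Km = sorted_list_of_set (K \<inter> {0..<int (Suc l)})"
  define Kr where "Kr = sorted_list_of_set (K \<inter> {int l<..})"
  have split: "sorted_list_of_set (K \<inter> {..<0} \<union> M \<union> K \<inter> {int l<..}) = Kl @ sorted_list_of_set M @ Kr"
    if "M \<subseteq> {0..<int (Suc l)}" for M
  proof -
    have M: "finite M" using that by (rule finite_subset) simp
    have "sorted_list_of_set (K \<inter> {..<0} \<union> (M \<union> K \<inter> {int l<..})) =
        Kl @ sorted_list_of_set (M \<union> K \<inter> {int l<..})"
      unfolding Kl_def using fin M that by (intro sorted_list_of_set_union) auto
    moreover have "sorted_list_of_set (M \<union> K \<inter> {int l<..}) = sorted_list_of_set M @ Kr"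
      unfolding Kr_def using fin M that by (intro sorted_list_of_set_union) auto
    ultimately show ?thesis by (simp add: Un_assoc)
  qed
  have "K = K \<inter> {..<0} \<union> K \<inter> {0..<int (Suc l)} \<union> K \<inter> {int l<..}" by auto
  then have K: "sorted_list_of_set K = Kl @ Km @ Kr"
    using split[of "K \<inter> {0..<int (Suc l)}"] by (simp add: Km_def)
  have Kl: "set Kl \<subseteq> {..<0}" and Km: "set Km \<subseteq> {0..int l}" and Kr: "set Kr \<subseteq> {int l<..}"
    using fin by (auto simp: Kl_def Km_def Kr_def)
  define hs where "hs = map (wt l) Kl"
  define gs where "gs = map (wt l) (Km @ Kr)"
  define A where "A = map (\<lambda>k. wt (Suc (Suc l)) (1 + k)) Kl"
  define B where "B = map (\<lambda>k. wt (Suc (Suc l)) (1 + k)) Kr"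
  define c :: "nat \<Rightarrow> int" where "c q = of_bool ((Km @ Kr) ! q \<le> int l)" for q
  have Kmr: "0 \<le> (Km @ Kr) ! q" if "q < length (Km @ Kr)" for q
    using nth_mem[OF that] Km Kr by auto
  have A: "map (\<lambda>f i. var_powi i (-1) * f i) hs = A"
    unfolding A_def hs_def using Kl by (auto simp: wt_shift_neg)
  have B: "map (\<lambda>f i. (1 + var i) * (1 + var_powi i (-1)) * f i) (map (wt l) Kr) = B"
    unfolding B_def using Kr by (auto simp: wt_shift_right)
  have c1: "c q = 1" if "q < length Km" for q
    using subsetD[OF Km nth_mem[OF that]] that by (simp add: c_def nth_append)
  have c0: "c q = 0" if "q \<in> {..<length gs} - {..<length Km}" for q
  proof -
    have q: "length Km \<le> q" "q - length Km < length Kr" using that by (auto simp: gs_def)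
    show ?thesis
      using subsetD[OF Kr nth_mem[OF q(2)]] q by (simp add: c_def nth_append)
  qed
  have "Phi (map (wt l) (sorted_list_of_set K)) = Phi (hs @ gs)"
    by (simp add: K hs_def gs_def)
  also have "\<dots> = (\<Sum>q<length gs. (-1) ^ q * c q *
    Phi (map (\<lambda>f i. var_powi i (-1) * f i) hs @
         map (\<lambda>f i. (1 + var i) * f i) (take q gs) @
         map (\<lambda>f i. (1 + var i) * (1 + var_powi i (-1)) * f i) (drop (Suc q) gs)))"
  proof (rule Phi_expand)
    show "\<forall>f\<in>set hs. univariate f \<and> (\<forall>i. expo_ge 1 i 1 (f i))"
      using Kl by (auto simp: hs_def univariate_wt expo_ge_wt_neg)
    show "\<forall>q<length gs. univariate (gs ! q) \<and> (\<forall>i. expo_ge (-1) i 1 ((gs ! q) i - of_int (c q)))"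
    proof (intro allI impI)
      fix q assume "q < length gs"
      then have q: "q < length (Km @ Kr)" by (simp add: gs_def)
      then have "gs ! q = wt l ((Km @ Kr) ! q)" unfolding gs_def by (rule nth_map)
      then show "univariate (gs ! q) \<and> (\<forall>i. expo_ge (-1) i 1 ((gs ! q) i - of_int (c q)))"
        using expo_ge_wt_nonneg[OF Kmr[OF q]] univariate_wt unfolding c_def by metis
    qed
    show "hs @ gs \<noteq> []"
      using ne fin arg_cong[OF K, of set] by (auto simp: hs_def gs_def)
  qed
  also have "\<dots> = (\<Sum>q<length Km. (-1) ^ q * c q *
    Phi (map (\<lambda>f i. var_powi i (-1) * f i) hs @
         map (\<lambda>f i. (1 + var i) * f i) (take q gs) @
         map (\<lambda>f i. (1 + var i) * (1 + var_powi i (-1)) * f i) (drop (Suc q) gs)))"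
    by (rule sum.mono_neutral_right) (auto simp: c0, auto simp: gs_def)
  also have "\<dots> = omit_sum A Km B"
    unfolding omit_sum_def
  proof (rule sum.cong[OF refl])
    fix q assume q: "q \<in> {..<length Km}"
    have "map (\<lambda>f i. (1 + var i) * f i) (take q gs) = map sumw (take q Km)"
      using q Km by (auto simp: gs_def take_map wt_sumw dest!: in_set_takeD)
    moreover have "drop (Suc q) gs = map (wt l) (drop (Suc q) Km) @ map (wt l) Kr"
      using q by (simp add: gs_def drop_map)
    moreover have "map (\<lambda>f i. (1 + var i) * (1 + var_powi i (-1)) * f i) (map (wt l) (drop (Suc q) Km)) =
        map (\<lambda>k. sumw (k + 1)) (drop (Suc q) Km)"
      using q Km by (auto simp: wt_sumw dest!: in_set_dropD)
    ultimately show "(-1) ^ q * c q *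
      Phi (map (\<lambda>f i. var_powi i (-1) * f i) hs @
         map (\<lambda>f i. (1 + var i) * f i) (take q gs) @
         map (\<lambda>f i. (1 + var i) * (1 + var_powi i (-1)) * f i) (drop (Suc q) gs)) =
      (-1) ^ q * Phi (A @ map sumw (take q Km) @ map (\<lambda>k. sumw (k + 1)) (drop (Suc q) Km) @ B)"
      using c1 q A B by (simp del: map_map)
  qed
  also have "\<dots> = (\<Sum>M\<in>scan K (Suc l) 1. Phi (A @ map colw (sorted_list_of_set M) @ B))"
    unfolding Km_def using univariate_wt
    by (intro sum_scan(1)[symmetric]) (auto simp: A_def B_def univariate_def)
  also have "\<dots> = (\<Sum>M\<in>scan K (Suc l) 1. Phi (map (wt (Suc (Suc l)))
      (sorted_list_of_set ((+) 1 ` (K \<inter> {..<0} \<union> M \<union> K \<inter> {int l<..})))))"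
  proof (rule sum.cong[OF refl])
    fix M assume M: "M \<in> scan K (Suc l) 1"
    then have sub: "M \<subseteq> {0..<int (Suc l)}" by (auto simp: scan_def)
    have mid: "map (\<lambda>k. wt (Suc (Suc l)) (1 + k)) (sorted_list_of_set M) = map colw (sorted_list_of_set M)"
      using scan_finite_mem[OF M] sub by (auto intro!: wt_mid)
    have "map (wt (Suc (Suc l))) (sorted_list_of_set ((+) 1 ` (K \<inter> {..<0} \<union> M \<union> K \<inter> {int l<..}))) =
        A @ map (\<lambda>k. wt (Suc (Suc l)) (1 + k)) (sorted_list_of_set M) @ B"
      using scan_finite_mem[OF M] fin
      by (subst sorted_list_of_set_plus) (auto simp: split[OF sub] A_def B_def)
    then show "Phi (A @ map colw (sorted_list_of_set M) @ B) = Phi (map (wt (Suc (Suc l)))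
      (sorted_list_of_set ((+) 1 ` (K \<inter> {..<0} \<union> M \<union> K \<inter> {int l<..}))))"
      by (simp only: mid)
  qed
  also have "\<dots> = (\<Sum>K'\<in>row_preds l K. Phi (map (wt (Suc (Suc l))) (sorted_list_of_set ((+) 1 ` K'))))"
  proof -
    have "M = (K \<inter> {..<0} \<union> M \<union> K \<inter> {int l<..}) \<inter> {0..<int (Suc l)}" if "M \<in> scan K (Suc l) 1" for M
      using that by (auto simp: scan_def)
    then have "inj_on (\<lambda>M. K \<inter> {..<0} \<union> M \<union> K \<inter> {int l<..}) (scan K (Suc l) 1)"
      by (rule inj_on_inverseI[where g = "\<lambda>K'. K' \<inter> {0..<int (Suc l)}", OF sym])
    then show ?thesis
      unfolding row_preds_def by (subst sum.reindex) auto
  qed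
  finally show ?thesis .
qed

section \<open>Alternating sign arrays\<close>

subsection \<open>Partial sums of alternating sequences\<close>

definition starts_pos :: "'a::linorder set \<Rightarrow> ('a \<Rightarrow> int) \<Rightarrow> bool" where
  "starts_pos I f \<longleftrightarrow> (\<forall>a\<in>I. f a \<noteq> 0 \<and> (\<forall>k\<in>I. k < a \<longrightarrow> f k = 0) \<longrightarrow> f a > 0)"

lemma sum_atLeastAtMost_int_Suc:
  fixes f :: "int \<Rightarrow> int"
  assumes "lo \<le> c + 1"
  shows "(\<Sum>k\<in>{lo..c + 1}. f k) = (\<Sum>k\<in>{lo..c}. f k) + f (c + 1)"
proof -
  have "{lo..c + 1} = insert (c + 1) {lo..c}" using assms by auto
  then show ?thesis by simp
qed

lemma alternates_imp_psum:
  fixes f :: "int \<Rightarrow> int"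
  assumes val: "\<forall>k\<in>{lo..hi}. f k \<in> {-1, 0, 1}"
    and alt: "alternates_on {lo..hi} f" and pos: "starts_pos {lo..hi} f"
    and c: "c \<in> {lo..hi}"
  shows "(\<Sum>k\<in>{lo..c}. f k) \<in> {0, 1}"
proof -
  \<comment> \<open>The invariant: either no nonzero entry has occurred yet, or the last one, at
    \<open>a\<close>, decides whether the partial sum is 1 or 0.\<close>
  define P where "P c \<longleftrightarrow> ((\<forall>k\<in>{lo..c}. f k = 0) \<and> (\<Sum>k\<in>{lo..c}. f k) = 0) \<or>
     (\<exists>a\<in>{lo..c}. f a \<noteq> 0 \<and> (\<forall>k\<in>{lo..c}. a < k \<longrightarrow> f k = 0) \<and> (\<Sum>k\<in>{lo..c}. f k) = of_bool (f a = 1))" for c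
  have "c \<le> hi \<longrightarrow> P c" if "lo - 1 \<le> c" for c
    using that
  proof (induction c rule: int_ge_induct)
    case base
    show ?case by (simp add: P_def)
  next
    case (step c)
    show ?case
    proof
      assume hi: "c + 1 \<le> hi"
      have lo: "lo \<le> c + 1" using step by simp
      have ins: "{lo..c + 1} = insert (c + 1) {lo..c}" using lo by auto
      note S = sum_atLeastAtMost_int_Suc[OF lo, of f]
      have v: "f (c + 1) \<in> {-1, 0, 1}" using val hi lo by auto
      have "P c" using step hi by simp
      then consider "\<forall>k\<in>{lo..c}. f k = 0" "(\<Sum>k\<in>{lo..c}. f k) = 0"
        | a where "a \<in> {lo..c}" "f a \<noteq> 0" "\<forall>k\<in>{lo..c}. a < k \<longrightarrow> f k = 0"
          "(\<Sum>k\<in>{lo..c}. f k) = of_bool (f a = 1)"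
        unfolding P_def by blast
      then show "P (c + 1)"
      proof cases
        case 1
        show ?thesis
        proof (cases "f (c + 1) = 0")
          case True
          then show ?thesis using 1 by (auto simp: P_def ins S)
        next
          case False
          have "f (c + 1) > 0"
            using pos[unfolded starts_pos_def, rule_format, of "c + 1"] 1 False lo hi by auto
          then have "f (c + 1) = 1" using v by auto
          then show ?thesis using 1 S lo unfolding P_def by (intro disjI2 bexI[of _ "c + 1"]) auto
        qed
      next
        case 2
        show ?thesis
        proof (cases "f (c + 1) = 0")
          case True
          then show ?thesis using 2 unfolding P_def S ins by (intro disjI2 bexI[of _ a]) auto
        next
          case False
          have "sgn (f (c + 1)) = - sgn (f a)"
            using alt[unfolded alternates_on_def, rule_format, of a "c + 1"] 2 False lo hi by auto
          moreover have "f a \<in> {-1, 0, 1}" using val 2 hi by auto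
          ultimately have "f (c + 1) = - f a" "f a = 1 \<or> f a = -1" using v 2 by auto
          then show ?thesis using 2 S lo unfolding P_def by (intro disjI2 bexI[of _ "c + 1"]) auto
        qed
      qed
    qed
  qed
  then have "P c" using c by auto
  then show ?thesis by (auto simp: P_def)
qed

text \<open>Entries are differences of consecutive partial sums. Two successive nonzero entries of
  equal sign would change the partial sum by 2.\<close>

lemma psum_imp_alternates:
  fixes f :: "int \<Rightarrow> int"
  assumes psum: "\<forall>c\<in>{lo..hi}. (\<Sum>k\<in>{lo..c}. f k) \<in> {0, 1}"
  shows "alternates_on {lo..hi} f" and "starts_pos {lo..hi} f" and "\<forall>k\<in>{lo..hi}. f k \<in> {-1, 0, 1}"
proof -
  have psum': "(\<Sum>k\<in>{lo..c}. f k) \<in> {0, 1}" if "c \<le> hi" for c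
    using psum that by (cases "lo \<le> c") auto
  have diff: "(\<Sum>k\<in>{lo..a}. f k) = (\<Sum>k\<in>{lo..a - 1}. f k) + f a" if "lo \<le> a" for a
    using sum_atLeastAtMost_int_Suc[of lo "a - 1" f] that by simp
  show val: "\<forall>k\<in>{lo..hi}. f k \<in> {-1, 0, 1}"
  proof
    fix k assume "k \<in> {lo..hi}"
    then show "f k \<in> {-1, 0, 1}" using diff[of k] psum'[of k] psum'[of "k - 1"] by auto
  qed
  show "starts_pos {lo..hi} f"
    unfolding starts_pos_def
  proof (intro ballI impI)
    fix a assume a: "a \<in> {lo..hi}" "f a \<noteq> 0 \<and> (\<forall>k\<in>{lo..hi}. k < a \<longrightarrow> f k = 0)"
    then have "(\<Sum>k\<in>{lo..a - 1}. f k) = 0" by (intro sum.neutral) auto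
    then show "f a > 0" using diff[of a] psum'[of a] a by auto
  qed
  show "alternates_on {lo..hi} f"
    unfolding alternates_on_def
  proof (intro ballI impI)
    fix a b assume ab: "a \<in> {lo..hi}" "b \<in> {lo..hi}"
      "a < b \<and> f a \<noteq> 0 \<and> f b \<noteq> 0 \<and> (\<forall>k\<in>{lo..hi}. a < k \<and> k < b \<longrightarrow> f k = 0)"
    have "{lo..b - 1} = {lo..a} \<union> {a<..<b}" using ab by auto
    then have "(\<Sum>k\<in>{lo..b - 1}. f k) = (\<Sum>k\<in>{lo..a}. f k) + (\<Sum>k\<in>{a<..<b}. f k)"
      by (metis (no_types) sum.union_disjoint finite_atLeastAtMost_int finite_greaterThanLessThan_int
          disjoint_iff atLeastAtMost_iff greaterThanLessThan_iff linorder_not_less)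
    also have "(\<Sum>k\<in>{a<..<b}. f k) = 0" using ab by (intro sum.neutral) auto
    finally have "(\<Sum>k\<in>{lo..b}. f k) = (\<Sum>k\<in>{lo..a - 1}. f k) + f a + f b"
      using diff[of a] diff[of b] ab by simp
    then have "f a + f b \<in> {-1, 0, 1}" using psum'[of b] psum'[of "a - 1"] ab by auto
    moreover have "f a \<in> {-1, 1}" "f b \<in> {-1, 1}" using val ab by auto
    ultimately show "sgn (f b) = - sgn (f a)" by auto
  qed
qed

text \<open>Row sum 1 forces the first nonzero entry to be positive: otherwise the negated row would
  start positively and have sum 0 or 1, not -1.\<close>

lemma alternating_row_iff:
  fixes f :: "int \<Rightarrow> int"
  assumes sum: "(\<Sum>k\<in>{lo..hi}. f k) = 1"
  shows "(\<forall>k\<in>{lo..hi}. f k \<in> {-1, 0, 1}) \<and> alternates_on {lo..hi} f \<longleftrightarrow>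
    (\<forall>c\<in>{lo..hi}. (\<Sum>k\<in>{lo..c}. f k) \<in> {0, 1})"
proof
  assume *: "(\<forall>k\<in>{lo..hi}. f k \<in> {-1, 0, 1}) \<and> alternates_on {lo..hi} f"
  have ne: "lo \<le> hi" using sum by (cases "lo \<le> hi") auto
  have "starts_pos {lo..hi} f"
  proof (rule ccontr)
    assume "\<not> starts_pos {lo..hi} f"
    then obtain a where a: "a \<in> {lo..hi}" "f a < 0" "\<forall>k\<in>{lo..hi}. k < a \<longrightarrow> f k = 0"
      unfolding starts_pos_def by force
    have "starts_pos {lo..hi} (\<lambda>k. - f k)"
      unfolding starts_pos_def
    proof (intro ballI impI)
      fix b assume b: "b \<in> {lo..hi}" "- f b \<noteq> 0 \<and> (\<forall>k\<in>{lo..hi}. k < b \<longrightarrow> - f k = 0)"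
      then have "b = a" using a by (cases b a rule: linorder_cases) auto
      then show "- f b > 0" using a by simp
    qed
    moreover have "alternates_on {lo..hi} (\<lambda>k. - f k)"
      using * by (auto simp: alternates_on_def sgn_minus)
    moreover have "\<forall>k\<in>{lo..hi}. - f k \<in> {-1, 0, 1}" using * by force
    ultimately have "(\<Sum>k\<in>{lo..hi}. - f k) \<in> {0, 1}"
      using alternates_imp_psum[of lo hi "\<lambda>k. - f k" hi] ne by auto
    then show False using sum by (simp add: sum_negf)
  qed
  then show "\<forall>c\<in>{lo..hi}. (\<Sum>k\<in>{lo..c}. f k) \<in> {0, 1}"
    using alternates_imp_psum * by blast
next
  assume "\<forall>c\<in>{lo..hi}. (\<Sum>k\<in>{lo..c}. f k) \<in> {0, 1}"
  then show "(\<forall>k\<in>{lo..hi}. f k \<in> {-1, 0, 1}) \<and> alternates_on {lo..hi} f"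
    using psum_imp_alternates by blast
qed

text \<open>Columns are read from the top, so the reflection of row \<open>i\<close> to
  \<open>- i\<close> reduces this to intervals of integers read from the left. Rows outside
  \<open>R\<close> only add zeros.\<close>

lemma alternating_column_iff:
  fixes h :: "nat \<Rightarrow> int"
  assumes R: "R \<subseteq> {1..n}" and zero: "\<And>i. i \<notin> R \<Longrightarrow> h i = 0"
    and val: "\<forall>i\<in>R. h i \<in> {-1, 0, 1}"
  shows "alternates_on R h \<and>
      (\<forall>i\<in>R. h i \<noteq> 0 \<and> (\<forall>k\<in>R. i < k \<longrightarrow> h k = 0) \<longrightarrow> h i > 0) \<longleftrightarrow>
    (\<forall>j\<ge>1. (\<Sum>i\<in>{j..n}. h i) \<in> {0, 1})"
proof -
  define g where "g k = h (nat (- k))" for k :: int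
  let ?I = "{- int n..-1}"
  have nz: "nat (- k) \<in> R" "k = - int (nat (- k))" if "g k \<noteq> 0" for k
  proof -
    show *: "nat (- k) \<in> R" using zero[of "nat (- k)"] that by (auto simp: g_def)
    then show "k = - int (nat (- k))" using R by (cases "k \<le> 0") auto
  qed
  have gh: "g (- int i) = h i" for i by (simp add: g_def)
  have in_I: "- int i \<in> ?I" if "i \<in> R" for i using that R by auto
  have val': "\<forall>k\<in>?I. g k \<in> {-1, 0, 1}"
    using val zero unfolding g_def by (metis insertCI)
  have alt: "alternates_on R h \<longleftrightarrow> alternates_on ?I g"
  proof
    assume L: "alternates_on R h"
    show "alternates_on ?I g"
      unfolding alternates_on_def
    proof (intro ballI impI)
      fix a b assume ab: "a \<in> ?I" "b \<in> ?I" "a < b \<and> g a \<noteq> 0 \<and> g b \<noteq> 0 \<and> (\<forall>k\<in>?I. a < k \<and> k < b \<longrightarrow> g k = 0)"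
      have "h k = 0" if "k \<in> R" "nat (- b) < k" "k < nat (- a)" for k
      proof -
        have "a < - int k" "- int k < b" using that ab(1,2) by auto
        then have "g (- int k) = 0" using ab(3) in_I[OF that(1)] by blast
        then show ?thesis by (simp add: gh)
      qed
      moreover have "nat (- b) < nat (- a)" using ab by auto
      moreover have "nat (- a) \<in> R" "nat (- b) \<in> R" "h (nat (- a)) \<noteq> 0" "h (nat (- b)) \<noteq> 0"
        using nz(1)[of a] nz(1)[of b] ab(3) by (simp_all add: g_def)
      ultimately have "sgn (h (nat (- a))) = - sgn (h (nat (- b)))"
        using L unfolding alternates_on_def by blast
      then show "sgn (g b) = - sgn (g a)" by (simp add: g_def)
    qed
  next
    assume L: "alternates_on ?I g"
    show "alternates_on R h"
      unfolding alternates_on_def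
    proof (intro ballI impI)
      fix a b assume ab: "a \<in> R" "b \<in> R" "a < b \<and> h a \<noteq> 0 \<and> h b \<noteq> 0 \<and> (\<forall>k\<in>R. a < k \<and> k < b \<longrightarrow> h k = 0)"
      have "g k = 0" if "k \<in> ?I" "- int b < k" "k < - int a" for k
      proof (rule ccontr)
        assume "g k \<noteq> 0"
        from nz[OF this] have "nat (- k) \<in> R" "a < nat (- k)" "nat (- k) < b" using that by auto
        then show False using ab \<open>g k \<noteq> 0\<close> by (auto simp: g_def)
      qed
      moreover have "- int b < - int a" "g (- int a) \<noteq> 0" "g (- int b) \<noteq> 0"
        using ab(3) by (simp_all add: gh)
      ultimately have "sgn (g (- int a)) = - sgn (g (- int b))"
        using L in_I[OF ab(1)] in_I[OF ab(2)] unfolding alternates_on_def by blast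
      then show "sgn (h b) = - sgn (h a)" by (simp add: gh)
    qed
  qed
  have pos: "(\<forall>i\<in>R. h i \<noteq> 0 \<and> (\<forall>k\<in>R. i < k \<longrightarrow> h k = 0) \<longrightarrow> h i > 0) \<longleftrightarrow> starts_pos ?I g"
  proof
    assume L: "\<forall>i\<in>R. h i \<noteq> 0 \<and> (\<forall>k\<in>R. i < k \<longrightarrow> h k = 0) \<longrightarrow> h i > 0"
    show "starts_pos ?I g"
      unfolding starts_pos_def
    proof (intro ballI impI)
      fix a assume a: "a \<in> ?I" "g a \<noteq> 0 \<and> (\<forall>k\<in>?I. k < a \<longrightarrow> g k = 0)"
      have "h k = 0" if "k \<in> R" "nat (- a) < k" for k
      proof -
        have "- int k < a" using that a(1) by auto
        then have "g (- int k) = 0" using a(2) in_I[OF that(1)] by blast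
        then show ?thesis by (simp add: gh)
      qed
      moreover have "nat (- a) \<in> R" "h (nat (- a)) \<noteq> 0" using nz(1)[of a] a(2) by (simp_all add: g_def)
      ultimately have "h (nat (- a)) > 0" using L by blast
      then show "g a > 0" by (simp add: g_def)
    qed
  next
    assume L: "starts_pos ?I g"
    show "\<forall>i\<in>R. h i \<noteq> 0 \<and> (\<forall>k\<in>R. i < k \<longrightarrow> h k = 0) \<longrightarrow> h i > 0"
    proof (intro ballI impI)
      fix i assume i: "i \<in> R" "h i \<noteq> 0 \<and> (\<forall>k\<in>R. i < k \<longrightarrow> h k = 0)"
      have "g k = 0" if "k \<in> ?I" "k < - int i" for k
      proof (rule ccontr)
        assume "g k \<noteq> 0"
        from nz[OF this] have "nat (- k) \<in> R" "i < nat (- k)" using that by auto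
        then show False using i \<open>g k \<noteq> 0\<close> by (auto simp: g_def)
      qed
      moreover have "g (- int i) \<noteq> 0" using i(2) by (simp add: gh)
      ultimately have "g (- int i) > 0" using L in_I[OF i(1)] unfolding starts_pos_def by blast
      then show "h i > 0" by (simp add: gh)
    qed
  qed
  have psum: "(\<Sum>k\<in>{- int n..- int j}. g k) = (\<Sum>i\<in>{j..n}. h i)" for j
    by (rule sum.reindex_bij_witness[of _ "\<lambda>i. - int i" "\<lambda>k. nat (- k)"]) (auto simp: g_def)
  have "(\<forall>c\<in>?I. (\<Sum>k\<in>{- int n..c}. g k) \<in> {0, 1}) \<longleftrightarrow> (\<forall>j\<ge>1. (\<Sum>i\<in>{j..n}. h i) \<in> {0, 1})"
  proof
    assume L: "\<forall>c\<in>?I. (\<Sum>k\<in>{- int n..c}. g k) \<in> {0, 1}"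
    show "\<forall>j\<ge>1. (\<Sum>i\<in>{j..n}. h i) \<in> {0, 1}"
    proof (intro allI impI)
      fix j :: nat assume "1 \<le> j"
      then show "(\<Sum>i\<in>{j..n}. h i) \<in> {0, 1}"
      proof (cases "j \<le> n")
        case True
        then have "- int j \<in> ?I" using \<open>1 \<le> j\<close> by auto
        then show ?thesis using L psum[of j] by metis
      qed auto
    qed
  next
    assume L: "\<forall>j\<ge>1. (\<Sum>i\<in>{j..n}. h i) \<in> {0, 1}"
    show "\<forall>c\<in>?I. (\<Sum>k\<in>{- int n..c}. g k) \<in> {0, 1}"
    proof
      fix c assume c: "c \<in> ?I"
      then have "c = - int (nat (- c))" "1 \<le> nat (- c)" by auto
      then show "(\<Sum>k\<in>{- int n..c}. g k) \<in> {0, 1}" using L psum[of "nat (- c)"] by metis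
    qed
  qed
  moreover have "alternates_on ?I g \<and> starts_pos ?I g \<longleftrightarrow> (\<forall>c\<in>?I. (\<Sum>k\<in>{- int n..c}. g k) \<in> {0, 1})"
    using alternates_imp_psum[OF val'] psum_imp_alternates[of "- int n" "-1" g] by blast
  ultimately show ?thesis unfolding alt pos by simp
qed

subsection \<open>Removing the bottom row\<close>

text \<open>The sign conditions are stated through partial sums, and the central columns are unrestricted.\<close>

definition AS_array :: "nat \<Rightarrow> nat \<Rightarrow> (nat \<Rightarrow> int \<Rightarrow> int) \<Rightarrow> bool" where
  "AS_array n l A \<longleftrightarrow>
     (\<forall>i c. i \<notin> {1..n} \<or> c \<notin> row_cols l i \<longrightarrow> A i c = 0) \<and>
     (\<forall>i\<in>{1..n}. (\<Sum>k\<in>row_cols l i. A i k) = 1) \<and>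
     (\<forall>i\<in>{1..n}. \<forall>c\<in>row_cols l i. (\<Sum>k\<in>{- int i + 1..c}. A i k) \<in> {0, 1}) \<and>
     (\<forall>c. \<forall>j\<ge>1. (\<Sum>i\<in>{j..n}. A i c) \<in> {0, 1})"

lemma AS_arrayD:
  assumes "AS_array n l A"
  shows "i \<notin> {1..n} \<or> c \<notin> row_cols l i \<Longrightarrow> A i c = 0"
    and "i \<in> {1..n} \<Longrightarrow> (\<Sum>k\<in>row_cols l i. A i k) = 1"
    and "i \<in> {1..n} \<Longrightarrow> c \<in> row_cols l i \<Longrightarrow> (\<Sum>k\<in>{- int i + 1..c}. A i k) \<in> {0, 1}"
    and "1 \<le> j \<Longrightarrow> (\<Sum>i\<in>{j..n}. A i c) \<in> {0, 1}"
  using assms unfolding AS_array_def by blast+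

definition one_cols :: "nat \<Rightarrow> (nat \<Rightarrow> int \<Rightarrow> int) \<Rightarrow> int set" where
  "one_cols n A = {c. (\<Sum>i\<in>{1..n}. A i c) = 1}"

definition arrays :: "nat \<Rightarrow> nat \<Rightarrow> int set \<Rightarrow> (nat \<Rightarrow> int \<Rightarrow> int) set" where
  "arrays n l K = {A. AS_array n l A \<and> one_cols n A = K}"

lemma AS_trapezoid_iff:
  "AS_trapezoid n l A \<longleftrightarrow> AS_array n l A \<and> (\<forall>c\<in>{1..int l - 1}. col_sum n l A c = 0)"
proof -
  define supp where "supp \<longleftrightarrow> (\<forall>i c. i \<notin> {1..n} \<or> c \<notin> row_cols l i \<longrightarrow> A i c = 0)"
  define rs where "rs \<longleftrightarrow> (\<forall>i\<in>{1..n}. (\<Sum>c\<in>row_cols l i. A i c) = 1)"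
  define val where "val \<longleftrightarrow> (\<forall>i\<in>{1..n}. \<forall>c\<in>row_cols l i. A i c \<in> {-1, 0, 1})"
  define alt where "alt \<longleftrightarrow> (\<forall>i\<in>{1..n}. alternates_on (row_cols l i) (A i))"
  define psr where "psr \<longleftrightarrow> (\<forall>i\<in>{1..n}. \<forall>c\<in>row_cols l i. (\<Sum>k\<in>{- int i + 1..c}. A i k) \<in> {0, 1})"
  define col where "col c \<longleftrightarrow> alternates_on (col_rows n l c) (\<lambda>i. A i c) \<and>
     (\<forall>i\<in>col_rows n l c. A i c \<noteq> 0 \<and> (\<forall>k\<in>col_rows n l c. i < k \<longrightarrow> A k c = 0) \<longrightarrow> A i c > 0)" for c
  define psc where "psc c \<longleftrightarrow> (\<forall>j\<ge>1. (\<Sum>i\<in>{j..n}. A i c) \<in> {0, 1})" for c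
  have rows: "val \<and> alt \<longleftrightarrow> psr" if rs
  proof -
    have "(\<forall>c\<in>row_cols l i. A i c \<in> {-1, 0, 1}) \<and> alternates_on (row_cols l i) (A i) \<longleftrightarrow>
       (\<forall>c\<in>row_cols l i. (\<Sum>k\<in>{- int i + 1..c}. A i k) \<in> {0, 1})" if "i \<in> {1..n}" for i
      using alternating_row_iff[of "A i" "- int i + 1" "int l + int i - 1"] \<open>rs\<close> that
      by (simp add: row_cols_def rs_def)
    then show ?thesis unfolding val_def alt_def psr_def by blast
  qed
  have cols: "col c \<longleftrightarrow> psc c" if supp val for c
    unfolding col_def psc_def
    using that by (intro alternating_column_iff) (auto simp: col_rows_def supp_def val_def)
  \<comment> \<open>\<open>AS_array\<close> bounds the partial sums of all columns; those outside
    the trapezoid vanish identically.\<close>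
  have out: "psc c" if supp "c \<notin> trapezoid_cols n l" for c
  proof -
    have "A i c = 0" for i
    proof (cases "i \<in> {1..n}")
      case True
      then have "c \<notin> row_cols l i" using that by (auto simp: row_cols_def trapezoid_cols_def)
      then show ?thesis using that by (auto simp: supp_def)
    qed (use that in \<open>auto simp: supp_def\<close>)
    then show ?thesis by (simp add: psc_def)
  qed
  have "AS_trapezoid n l A \<longleftrightarrow> supp \<and> val \<and> rs \<and> (\<forall>c\<in>{1..int l - 1}. col_sum n l A c = 0) \<and> alt \<and>
      (\<forall>c\<in>trapezoid_cols n l. col c)"
    unfolding AS_trapezoid_def supp_def val_def rs_def alt_def col_def by blast
  moreover have "AS_array n l A \<longleftrightarrow> supp \<and> rs \<and> psr \<and> (\<forall>c. psc c)"
    unfolding AS_array_def supp_def rs_def psr_def psc_def by blast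
  ultimately show ?thesis using rows cols out by blast
qed

lemma col_sum_AS_array:
  assumes "AS_array n l A"
  shows "col_sum n l A c = (\<Sum>i\<in>{1..n}. A i c)"
  unfolding col_sum_def
  using assms by (intro sum.mono_neutral_left) (auto simp: col_rows_def AS_array_def)

text \<open>This form matches the conditions that \<open>AS_array\<close> puts on row 1, which
  occupies the columns \<open>0, ..., l\<close>.\<close>

lemma row_preds_iff:
  "K' \<in> row_preds l K \<longleftrightarrow>
    (\<forall>c. c \<notin> {0..int l} \<longrightarrow> (c \<in> K' \<longleftrightarrow> c \<in> K)) \<and>
    (\<forall>c\<in>{0..int l}. (\<Sum>k\<in>{0..c}. of_bool (k \<in> K) - of_bool (k \<in> K')) \<in> {0, 1 :: int}) \<and>
    (\<Sum>k\<in>{0..int l}. of_bool (k \<in> K) - of_bool (k \<in> K')) = (1 :: int)"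
proof -
  have ivl: "{0..<int (Suc d)} = {0..int d}" for d by auto
  have psum: "row_psum K (K' \<inter> {0..int l}) (Suc d) = (\<Sum>k\<in>{0..int d}. of_bool (k \<in> K) - of_bool (k \<in> K'))"
    if "d \<le> l" for d
    unfolding row_psum_def ivl using that by (intro sum.cong) auto
  have scan: "K' \<inter> {0..int l} \<in> scan K (Suc l) 1 \<longleftrightarrow>
    (\<forall>c\<in>{0..int l}. (\<Sum>k\<in>{0..c}. of_bool (k \<in> K) - of_bool (k \<in> K')) \<in> {0, 1 :: int}) \<and>
    (\<Sum>k\<in>{0..int l}. of_bool (k \<in> K) - of_bool (k \<in> K')) = (1 :: int)" (is "_ \<longleftrightarrow> ?R")
  proof
    assume L: "K' \<inter> {0..int l} \<in> scan K (Suc l) 1"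
    have "(\<Sum>k\<in>{0..c}. of_bool (k \<in> K) - of_bool (k \<in> K')) \<in> {0, 1 :: int}" if "c \<in> {0..int l}" for c
    proof -
      have c: "c = int (nat c)" "nat c \<le> l" using that by auto
      have "row_psum K (K' \<inter> {0..int l}) (Suc (nat c)) \<in> {0, 1}"
        using L c(2) unfolding scan_def by (metis (mono_tags, lifting) Suc_le_mono mem_Collect_eq)
      then show ?thesis using psum[OF c(2)] c(1) by metis
    qed
    moreover have "row_psum K (K' \<inter> {0..int l}) (Suc l) = 1" using L by (simp add: scan_def)
    ultimately show ?R using psum[of l] by simp
  next
    assume R: ?R
    have "row_psum K (K' \<inter> {0..int l}) d \<in> {0, 1}" if "d \<le> Suc l" for d
    proof (cases d)
      case 0
      then show ?thesis by (simp add: row_psum_def)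
    next
      case (Suc e)
      then show ?thesis using R psum[of e] that by auto
    qed
    moreover have "row_psum K (K' \<inter> {0..int l}) (Suc l) = 1" using R psum[of l] by simp
    ultimately show "K' \<inter> {0..int l} \<in> scan K (Suc l) 1" by (auto simp: scan_def)
  qed
  have "K' \<in> row_preds l K \<longleftrightarrow>
    (\<forall>c. c \<notin> {0..int l} \<longrightarrow> (c \<in> K' \<longleftrightarrow> c \<in> K)) \<and> K' \<inter> {0..int l} \<in> scan K (Suc l) 1"
  proof
    assume "K' \<in> row_preds l K"
    then obtain M where M: "M \<in> scan K (Suc l) 1" "K' = K \<inter> {..<0} \<union> M \<union> K \<inter> {int l<..}"
      by (auto simp: row_preds_def)
    then have sub: "M \<subseteq> {0..int l}" by (auto simp: scan_def)
    then have "K' \<inter> {0..int l} = M" using M(2) by auto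
    moreover have "\<forall>c. c \<notin> {0..int l} \<longrightarrow> (c \<in> K' \<longleftrightarrow> c \<in> K)" using M(2) sub by auto
    ultimately show "(\<forall>c. c \<notin> {0..int l} \<longrightarrow> (c \<in> K' \<longleftrightarrow> c \<in> K)) \<and> K' \<inter> {0..int l} \<in> scan K (Suc l) 1"
      using M(1) by simp
  next
    assume R: "(\<forall>c. c \<notin> {0..int l} \<longrightarrow> (c \<in> K' \<longleftrightarrow> c \<in> K)) \<and> K' \<inter> {0..int l} \<in> scan K (Suc l) 1"
    have "K' = K \<inter> {..<0} \<union> (K' \<inter> {0..int l}) \<union> K \<inter> {int l<..}"
    proof (intro set_eqI)
      fix c
      show "c \<in> K' \<longleftrightarrow> c \<in> K \<inter> {..<0} \<union> (K' \<inter> {0..int l}) \<union> K \<inter> {int l<..}"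
        using R by (cases "c \<in> {0..int l}") auto
    qed
    then show "K' \<in> row_preds l K" using R unfolding row_preds_def by blast
  qed
  then show ?thesis unfolding scan .
qed

text \<open>Columns are shifted by one so that the new bottom row starts in column 0 again.\<close>

definition drop_row :: "(nat \<Rightarrow> int \<Rightarrow> int) \<Rightarrow> nat \<Rightarrow> int \<Rightarrow> int" where
  "drop_row A i c = (if i = 0 then 0 else A (Suc i) (c - 1))"

text \<open>The restored row is the difference of the column sums with and without it. The shift
  \<open>c + 1\<close> translates to the column numbers of the smaller array.\<close>

definition add_row :: "nat \<Rightarrow> int set \<Rightarrow> (nat \<Rightarrow> int \<Rightarrow> int) \<Rightarrow> nat \<Rightarrow> int \<Rightarrow> int" where
  "add_row n K B i c = (if i = 0 then 0
     else if i = 1 then of_bool (c \<in> K) - of_bool (c + 1 \<in> one_cols n B)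
     else B (i - 1) (c + 1))"

lemma sum_shift_int:
  fixes f :: "int \<Rightarrow> int"
  shows "(\<Sum>k\<in>{a..b}. f (k - 1)) = (\<Sum>k\<in>{a - 1..b - 1}. f k)"
  by (rule sum.reindex_bij_witness[of _ "\<lambda>k. k + 1" "\<lambda>k. k - 1"]) auto

lemma drop_row_col_sum: "1 \<le> j \<Longrightarrow> (\<Sum>i\<in>{j..n}. drop_row A i c) = (\<Sum>i\<in>{Suc j..Suc n}. A i (c - 1))"
  unfolding sum.shift_bounds_cl_Suc_ivl by (rule sum.cong) (auto simp: drop_row_def)

text \<open>The column sums from row 1 and from row 2 upwards differ by the entry in row 1, and both
  are 0 or 1.\<close>

lemma AS_array_first_row:
  assumes A: "AS_array (Suc n) l A"
  shows "A 1 c = of_bool (c \<in> one_cols (Suc n) A) - of_bool (c + 1 \<in> one_cols n (drop_row A))"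
proof -
  define S where "S j = (\<Sum>i\<in>{j..Suc n}. A i c)" for j
  have "S 1 = A 1 c + S (Suc 1)"
    unfolding S_def by (rule sum.atLeast_Suc_atMost) simp
  moreover have "S 1 \<in> {0, 1}" "S (Suc 1) \<in> {0, 1}"
    using A by (simp_all only: AS_array_def S_def)
  moreover have "c + 1 \<in> one_cols n (drop_row A) \<longleftrightarrow> S (Suc 1) = 1"
    unfolding one_cols_def S_def using drop_row_col_sum[of 1 A "c + 1" n] by simp
  moreover have "c \<in> one_cols (Suc n) A \<longleftrightarrow> S 1 = 1"
    unfolding one_cols_def S_def by simp
  ultimately show ?thesis by auto
qed

lemma drop_row_in:
  assumes "A \<in> arrays (Suc n) l K"
  shows "\<exists>K'\<in>row_preds l K. drop_row A \<in> arrays n (Suc (Suc l)) ((+) 1 ` K')"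
proof -
  have A: "AS_array (Suc n) l A" and K: "K = one_cols (Suc n) A" using assms by (auto simp: arrays_def)
  \<comment> \<open>The columns with sum 1 above the bottom row, in the numbering of
    \<open>A\<close>.\<close>
  define K' where "K' = {c. c + 1 \<in> one_cols n (drop_row A)}"
  have cols: "one_cols n (drop_row A) = (+) 1 ` K'"
  proof (intro set_eqI iffI)
    fix c assume "c \<in> one_cols n (drop_row A)"
    then show "c \<in> (+) 1 ` K'" by (intro image_eqI[of _ _ "c - 1"]) (auto simp: K'_def)
  qed (auto simp: K'_def add.commute)
  have row1: "of_bool (c \<in> K) - of_bool (c \<in> K') = A 1 c" for c
    using AS_array_first_row[OF A, of c] by (simp add: K K'_def)
  have rc1: "row_cols l 1 = {0..int l}" by (simp add: row_cols_def)
  have "K' \<in> row_preds l K"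
    unfolding row_preds_iff row1
  proof (intro conjI allI impI ballI)
    fix c assume "c \<notin> {0..int l}"
    then have "A 1 c = 0" using A rc1 unfolding AS_array_def by blast
    then show "c \<in> K' \<longleftrightarrow> c \<in> K" using row1[of c] by (auto split: if_splits)
  next
    fix c assume "c \<in> {0..int l}"
    then show "(\<Sum>k\<in>{0..c}. A 1 k) \<in> {0, 1}"
      using AS_arrayD(3)[OF A, of 1 c] rc1 by simp
  next
    show "(\<Sum>k\<in>{0..int l}. A 1 k) = 1"
      using AS_arrayD(2)[OF A, of 1] rc1 by simp
  qed
  moreover have "AS_array n (Suc (Suc l)) (drop_row A)"
    unfolding AS_array_def
  proof (intro conjI allI impI ballI)
    fix i c assume *: "i \<notin> {1..n} \<or> c \<notin> row_cols (Suc (Suc l)) i"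
    show "drop_row A i c = 0"
    proof (cases "i = 0")
      case False
      then have "Suc i \<notin> {1..Suc n} \<or> c - 1 \<notin> row_cols l (Suc i)"
        using * by (auto simp: row_cols_def)
      then show ?thesis using AS_arrayD(1)[OF A] False by (simp add: drop_row_def)
    qed (simp add: drop_row_def)
  next
    fix i assume i: "i \<in> {1..n}"
    have "(\<Sum>k\<in>row_cols (Suc (Suc l)) i. drop_row A i k) = (\<Sum>k\<in>{- int i + 1..int (Suc (Suc l)) + int i - 1}. A (Suc i) (k - 1))"
      using i by (simp add: row_cols_def drop_row_def)
    also have "\<dots> = (\<Sum>k\<in>row_cols l (Suc i). A (Suc i) k)"
      unfolding sum_shift_int by (simp add: row_cols_def)
    also have "\<dots> = 1" using AS_arrayD(2)[OF A, of "Suc i"] i by simp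
    finally show "(\<Sum>k\<in>row_cols (Suc (Suc l)) i. drop_row A i k) = 1" .
    fix c assume c: "c \<in> row_cols (Suc (Suc l)) i"
    have "(\<Sum>k\<in>{- int i + 1..c}. drop_row A i k) = (\<Sum>k\<in>{- int i + 1..c}. A (Suc i) (k - 1))"
      using i by (simp add: drop_row_def)
    also have "\<dots> = (\<Sum>k\<in>{- int (Suc i) + 1..c - 1}. A (Suc i) k)"
      unfolding sum_shift_int by simp
    also have "\<dots> \<in> {0, 1}"
    proof -
      have "c - 1 \<in> row_cols l (Suc i)" "Suc i \<in> {1..Suc n}" using c i by (auto simp: row_cols_def)
      then show ?thesis using AS_arrayD(3)[OF A] by blast
    qed
    finally show "(\<Sum>k\<in>{- int i + 1..c}. drop_row A i k) \<in> {0, 1}" .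
  next
    fix c and j :: nat assume "1 \<le> j"
    then show "(\<Sum>i\<in>{j..n}. drop_row A i c) \<in> {0, 1}"
      using AS_arrayD(4)[OF A, of "Suc j"] by (simp only: drop_row_col_sum)
  qed
  ultimately show ?thesis using cols by (auto simp: arrays_def)
qed

lemma add_row_in:
  assumes B: "B \<in> arrays n (Suc (Suc l)) ((+) 1 ` K')" and K': "K' \<in> row_preds l K"
  shows "add_row n K B \<in> arrays (Suc n) l K"
proof -
  have AB: "AS_array n (Suc (Suc l)) B" and cols: "one_cols n B = (+) 1 ` K'"
    using B by (auto simp: arrays_def)
  have mem: "c + 1 \<in> one_cols n B \<longleftrightarrow> c \<in> K'" for c by (auto simp: cols)
  have row1: "add_row n K B 1 c = of_bool (c \<in> K) - of_bool (c \<in> K')" for c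
    by (simp add: add_row_def mem)
  have rowS: "add_row n K B (Suc i) c = B i (c + 1)" if "1 \<le> i" for i c
    using that by (simp add: add_row_def)
  note P = K'[unfolded row_preds_iff]
  have sumB: "(\<Sum>i\<in>{1..n}. B i (c + 1)) = of_bool (c \<in> K')" for c
  proof -
    have "(\<Sum>i\<in>{1..n}. B i (c + 1)) \<in> {0, 1}" using AS_arrayD(4)[OF AB] by blast
    then show ?thesis using mem[of c] by (auto simp: one_cols_def)
  qed
  have colS: "(\<Sum>i\<in>{Suc j..Suc n}. add_row n K B i c) = (\<Sum>i\<in>{j..n}. B i (c + 1))" if "1 \<le> j" for j c
    unfolding sum.shift_bounds_cl_Suc_ivl using that by (intro sum.cong) (auto simp: rowS)
  have col1: "(\<Sum>i\<in>{1..Suc n}. add_row n K B i c) = of_bool (c \<in> K)" for c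
  proof -
    have "(\<Sum>i\<in>{1..Suc n}. add_row n K B i c) = add_row n K B 1 c + (\<Sum>i\<in>{Suc 1..Suc n}. add_row n K B i c)"
      by (rule sum.atLeast_Suc_atMost) simp
    then show ?thesis using colS[of 1 c] by (simp add: row1 sumB del: One_nat_def)
  qed
  have rc1: "row_cols l 1 = {0..int l}" by (simp add: row_cols_def)
  have shift: "(\<Sum>k\<in>{a..b}. B i (k + 1)) = (\<Sum>k\<in>{a + 1..b + 1}. B i k)" for a b i
    using sum_shift_int[of "\<lambda>k. B i (k + 1)" "a + 1" "b + 1"] by simp
  have "AS_array (Suc n) l (add_row n K B)"
    unfolding AS_array_def
  proof (intro conjI allI impI ballI)
    fix i c assume *: "i \<notin> {1..Suc n} \<or> c \<notin> row_cols l i"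
    consider "i = 0" | "i = 1" | j where "i = Suc j" "1 \<le> j" by (cases i) (auto, linarith)
    then show "add_row n K B i c = 0"
    proof cases
      case 2
      then have "c \<notin> {0..int l}" using * rc1 by auto
      then show ?thesis using P 2 row1[of c] by auto
    next
      case 3
      then have "j \<notin> {1..n} \<or> c + 1 \<notin> row_cols (Suc (Suc l)) j" using * by (auto simp: row_cols_def)
      then show ?thesis using AS_arrayD(1)[OF AB] 3 rowS[of j c] by simp
    qed (simp add: add_row_def)
  next
    fix i assume i: "i \<in> {1..Suc n}"
    consider "i = 1" | j where "i = Suc j" "j \<in> {1..n}" using i by (cases i) (auto, linarith)
    then have "(\<Sum>k\<in>row_cols l i. add_row n K B i k) = 1 \<and>
      (\<forall>c\<in>row_cols l i. (\<Sum>k\<in>{- int i + 1..c}. add_row n K B i k) \<in> {0, 1})"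
    proof cases
      case 1
      then show ?thesis using P by (simp only: 1 rc1 row1) simp
    next
      case 2
      have s: "(\<Sum>k\<in>{a..b}. add_row n K B i k) = (\<Sum>k\<in>{a + 1..b + 1}. B j k)" for a b
        using 2 rowS[of j] shift[where i = j] by simp
      have "(\<Sum>k\<in>row_cols l i. add_row n K B i k) = (\<Sum>k\<in>row_cols (Suc (Suc l)) j. B j k)"
        unfolding row_cols_def s using 2 by (simp add: algebra_simps)
      moreover have "(\<Sum>k\<in>{- int i + 1..c}. add_row n K B i k) \<in> {0, 1}" if "c \<in> row_cols l i" for c
      proof -
        have "c + 1 \<in> row_cols (Suc (Suc l)) j" using that 2 by (auto simp: row_cols_def)
        then have "(\<Sum>k\<in>{- int j + 1..c + 1}. B j k) \<in> {0, 1}"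
          using AS_arrayD(3)[OF AB] 2 by blast
        then show ?thesis unfolding s using 2 by simp
      qed
      ultimately show ?thesis using AS_arrayD(2)[OF AB, of j] 2 by simp
    qed
    then show "(\<Sum>k\<in>row_cols l i. add_row n K B i k) = 1"
      and "\<And>c. c \<in> row_cols l i \<Longrightarrow> (\<Sum>k\<in>{- int i + 1..c}. add_row n K B i k) \<in> {0, 1}"
      by blast+
  next
    fix c and j :: nat assume "1 \<le> j"
    then consider "j = 1" | m where "j = Suc m" "1 \<le> m" by (cases j) (auto, linarith)
    then show "(\<Sum>i\<in>{j..Suc n}. add_row n K B i c) \<in> {0, 1}"
    proof cases
      case 1
      then show ?thesis using col1[of c] by (auto simp del: One_nat_def)
    next
      case 2
      then show ?thesis using AS_arrayD(4)[OF AB, of m "c + 1"] colS[of m c] by metis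
    qed
  qed
  moreover have "one_cols (Suc n) (add_row n K B) = K"
    unfolding one_cols_def col1 by auto
  ultimately show ?thesis by (simp add: arrays_def)
qed

text \<open>No information is lost, because \<open>K\<close> and the remaining rows determine the
  bottom row.\<close>

lemma bij_drop_row:
  "bij_betw drop_row (arrays (Suc n) l K) (\<Union>K'\<in>row_preds l K. arrays n (Suc (Suc l)) ((+) 1 ` K'))"
proof (rule bij_betw_byWitness[where f' = "add_row n K"])
  show "\<forall>A\<in>arrays (Suc n) l K. add_row n K (drop_row A) = A"
  proof
    fix A assume "A \<in> arrays (Suc n) l K"
    then have A: "AS_array (Suc n) l A" and K: "one_cols (Suc n) A = K" by (auto simp: arrays_def)
    show "add_row n K (drop_row A) = A"
    proof (intro ext)
      fix i c
      have "A 0 c = 0" using AS_arrayD(1)[OF A] by simp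
      then show "add_row n K (drop_row A) i c = A i c"
        using AS_array_first_row[OF A, of c] by (auto simp: add_row_def K drop_row_def)
    qed
  qed
  show "\<forall>B\<in>\<Union>K'\<in>row_preds l K. arrays n (Suc (Suc l)) ((+) 1 ` K'). drop_row (add_row n K B) = B"
  proof
    fix B assume "B \<in> (\<Union>K'\<in>row_preds l K. arrays n (Suc (Suc l)) ((+) 1 ` K'))"
    then have "AS_array n (Suc (Suc l)) B" by (auto simp: arrays_def)
    then have "B 0 c = 0" for c using AS_arrayD(1) by simp
    then show "drop_row (add_row n K B) = B"
      by (intro ext) (auto simp: drop_row_def add_row_def)
  qed
  show "drop_row ` arrays (Suc n) l K \<subseteq> (\<Union>K'\<in>row_preds l K. arrays n (Suc (Suc l)) ((+) 1 ` K'))"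
    using drop_row_in by blast
  show "add_row n K ` (\<Union>K'\<in>row_preds l K. arrays n (Suc (Suc l)) ((+) 1 ` K')) \<subseteq> arrays (Suc n) l K"
    using add_row_in by blast
qed

section \<open>Counting arrays by the recursion on the number of rows\<close>

lemma arrays_0: "arrays 0 l K = (if K = {} then {\<lambda>_ _. 0} else {})"
  by (auto simp: arrays_def AS_array_def one_cols_def fun_eq_iff)

lemma finite_row_preds [simp]: "finite (row_preds l K)"
  by (simp add: row_preds_def)

lemma finite_arrays [simp]: "finite (arrays n l K)"
proof (induction n arbitrary: l K)
  case (Suc n)
  then show ?case
    using bij_betw_finite[OF bij_drop_row[of n l K]] by simp
qed (simp add: arrays_0)

text \<open>The union is disjoint because an array determines its columns of sum 1, and the shift by
  1 is injective.\<close>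

lemma card_arrays_Suc:
  "card (arrays (Suc n) l K) = (\<Sum>K'\<in>row_preds l K. card (arrays n (Suc (Suc l)) ((+) 1 ` K')))"
proof -
  have "card (arrays (Suc n) l K) = card (\<Union>K'\<in>row_preds l K. arrays n (Suc (Suc l)) ((+) 1 ` K'))"
    by (rule bij_betw_same_card[OF bij_drop_row])
  also have "\<dots> = (\<Sum>K'\<in>row_preds l K. card (arrays n (Suc (Suc l)) ((+) 1 ` K')))"
    by (rule card_UN_disjoint) (simp, simp, auto simp: arrays_def inj_image_eq_iff)
  finally show ?thesis .
qed

text \<open>Outside the bottom row the two sets agree; inside it the row sum 1 is the difference of
  their sizes.\<close>

lemma row_preds_card:
  assumes K: "finite K" "card K = Suc n" and K': "K' \<in> row_preds l K"
  shows "finite K'" and "card K' = n"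
proof -
  have out: "K' - {0..int l} = K - {0..int l}"
    and sum: "(\<Sum>k\<in>{0..int l}. of_bool (k \<in> K) - of_bool (k \<in> K')) = (1 :: int)"
    using K' by (auto simp: row_preds_iff)
  have "K' \<subseteq> K \<union> {0..int l}" using out by auto
  then show fin: "finite K'" using K by (meson finite_UnI finite_atLeastAtMost_int finite_subset)
  have "int (card ({0..int l} \<inter> K)) - int (card ({0..int l} \<inter> K')) = 1"
    using sum by (simp add: sum_subtractf Collect_mem_eq)
  moreover have "card K = card ({0..int l} \<inter> K) + card (K - {0..int l})"
    using K card_Int_Diff[of K "{0..int l}"] by (simp add: Int_commute)
  moreover have "card K' = card ({0..int l} \<inter> K') + card (K' - {0..int l})"
    using fin card_Int_Diff[of K' "{0..int l}"] by (simp add: Int_commute)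
  ultimately show "card K' = n" using K out by simp
qed

text \<open>Both sides satisfy the same recursion, with \<open>l\<close> and \<open>K\<close>
  changing at each step. Without rows only the zero array remains, and the empty constant term is
  1.\<close>

lemma card_arrays_eq_Phi:
  assumes "finite K" "card K = n"
  shows "int (card (arrays n l K)) = Phi (map (wt l) (sorted_list_of_set K))"
  using assms
proof (induction n arbitrary: l K)
  case 0
  then show ?case by (simp add: arrays_0)
next
  case (Suc n)
  have "int (card (arrays (Suc n) l K)) = (\<Sum>K'\<in>row_preds l K. int (card (arrays n (Suc (Suc l)) ((+) 1 ` K'))))"
    by (simp add: card_arrays_Suc)
  also have "\<dots> = (\<Sum>K'\<in>row_preds l K. Phi (map (wt (Suc (Suc l))) (sorted_list_of_set ((+) 1 ` K'))))"
    using row_preds_card[OF Suc.prems]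
    by (intro sum.cong refl Suc.IH) (auto simp: card_image)
  also have "\<dots> = Phi (map (wt l) (sorted_list_of_set K))"
    using Suc.prems by (intro Phi_wt_rec[symmetric]) auto
  finally show ?case .
qed


section \<open>Trapezoids as arrays with prescribed columns of sum 1\<close>

lemma trapezoid_set_eq:
  assumes A: "AS_array n l A"
  shows "trapezoid_set n l A = {0} \<union> {c - 1 | c. c \<in> one_cols n A \<and> c \<le> 0} \<union>
    {c - (int l - 1) | c. c \<in> one_cols n A \<and> c \<ge> 1}"
proof -
  have "c \<in> trapezoid_cols n l \<and> col_sum n l A c > 0 \<longleftrightarrow> c \<in> one_cols n A" for c
  proof
    assume *: "c \<in> trapezoid_cols n l \<and> col_sum n l A c > 0"
    then show "c \<in> one_cols n A"
      using AS_arrayD(4)[OF A, of 1 c] col_sum_AS_array[OF A, of c] by (auto simp: one_cols_def)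
  next
    assume c: "c \<in> one_cols n A"
    then have "(\<Sum>i\<in>{1..n}. A i c) \<noteq> 0" by (simp add: one_cols_def)
    then obtain i where "i \<in> {1..n}" "A i c \<noteq> 0" by (meson sum.neutral)
    then have "c \<in> row_cols l i" "i \<le> n" using AS_arrayD(1)[OF A] by auto
    then have "c \<in> trapezoid_cols n l" by (auto simp: row_cols_def trapezoid_cols_def)
    then show "c \<in> trapezoid_cols n l \<and> col_sum n l A c > 0"
      using c col_sum_AS_array[OF A, of c] by (simp add: one_cols_def)
  qed
  then show ?thesis unfolding trapezoid_set_def by blast
qed

text \<open>\<open>K\<close> arises from the nonzero elements of \<open>S\<close> by opening a gap
  for the \<open>l - 1\<close> central columns; having no column of sum 1 in the gap is exactly the
  condition on central column sums.\<close>

lemma trapezoids_eq_arrays: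
  assumes K: "K \<inter> {1..int l - 1} = {}" and l: "l \<ge> 1"
    and S0: "0 \<in> S" and Sneg: "\<And>x. x < 0 \<Longrightarrow> x \<in> S \<longleftrightarrow> x + 1 \<in> K"
    and Spos: "\<And>x. x > 0 \<Longrightarrow> x \<in> S \<longleftrightarrow> x + (int l - 1) \<in> K"
  shows "{A. AS_trapezoid n l A \<and> trapezoid_set n l A = S} = arrays n l K"
proof (intro set_eqI iffI)
  fix A assume "A \<in> {A. AS_trapezoid n l A \<and> trapezoid_set n l A = S}"
  then have A: "AS_array n l A" and central: "\<forall>c\<in>{1..int l - 1}. col_sum n l A c = 0"
    and S: "trapezoid_set n l A = S" by (auto simp: AS_trapezoid_iff)
  \<comment> \<open>With the central columns excluded, the two halves of
    \<open>trapezoid_set\<close> are negative and positive, so they cannot collide.\<close>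
  have ge: "c \<ge> int l" if "c \<in> one_cols n A" "c \<ge> 1" for c
    using central col_sum_AS_array[OF A, of c] that by (force simp: one_cols_def)
  note S' = S[unfolded trapezoid_set_eq[OF A], symmetric]
  have "c \<in> one_cols n A \<longleftrightarrow> c \<in> K" for c
  proof (cases "c \<le> 0")
    case True
    have "c - 1 \<in> S \<longleftrightarrow> c \<in> one_cols n A"
      unfolding S' using True ge l by force
    then show ?thesis using Sneg[of "c - 1"] True by simp
  next
    case False
    show ?thesis
    proof (cases "c < int l")
      case True
      then show ?thesis using K False ge[of c] by auto
    next
      case cl: False
      have "c - (int l - 1) \<in> S \<longleftrightarrow> c \<in> one_cols n A"
        unfolding S' using False cl by force
      then show ?thesis using Spos[of "c - (int l - 1)"] cl by simp
    qed
  qed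
  then show "A \<in> arrays n l K" using A by (auto simp: arrays_def)
next
  fix A assume "A \<in> arrays n l K"
  then have A: "AS_array n l A" and cols: "one_cols n A = K" by (auto simp: arrays_def)
  have "col_sum n l A c = 0" if "c \<in> {1..int l - 1}" for c
    using that K cols AS_arrayD(4)[OF A, of 1 c] col_sum_AS_array[OF A, of c] by (auto simp: one_cols_def)
  moreover have "trapezoid_set n l A = S"
    unfolding trapezoid_set_eq[OF A] cols
  proof (intro set_eqI)
    fix x :: int
    have ge: "c \<ge> int l" if "c \<in> K" "c \<ge> 1" for c using K that by force
    consider "x < 0" | "x = 0" | "x > 0" by linarith
    then show "x \<in> {0} \<union> {c - 1 | c. c \<in> K \<and> c \<le> 0} \<union> {c - (int l - 1) | c. c \<in> K \<and> c \<ge> 1} \<longleftrightarrow> x \<in> S"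
    proof cases
      case 1
      then show ?thesis unfolding Sneg[OF 1] using ge by force
    next
      case 2
      then show ?thesis using S0 by simp
    next
      case 3
      then show ?thesis unfolding Spos[OF 3] using l by force
    qed
  qed
  ultimately show "A \<in> {A. AS_trapezoid n l A \<and> trapezoid_set n l A = S}"
    using A by (auto simp: AS_trapezoid_iff)
qed

section \<open>The explicit constant term in variables numbered from 1\<close>

lemma Phi_atLeast1:
  assumes "\<And>i. natural (f i)"
  shows "Phi (map f [1..<Suc n]) = constant_term
    ((\<Prod>i\<in>{1..n}. f i i * var_powi i (1 - int n)) *
     (\<Prod>(i, j)\<in>{(i, j). 1 \<le> i \<and> i < j \<and> j \<le> n}. kern i j))"
proof -
  have "Phi (map f [1..<Suc n]) = constant_term (integrand Suc (map f [1..<Suc n]))"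
    using assms by (intro Phi_rename[symmetric]) auto
  moreover have "integrand Suc (map f [1..<Suc n]) =
     (\<Prod>i<n. f (Suc i) (Suc i) * var_powi (Suc i) (1 - int n)) *
     (\<Prod>(i, j)\<in>index_pairs n. kern (Suc i) (Suc j))"
    unfolding integrand_def by (simp del: upt_Suc)
  moreover have "(\<Prod>i<n. f (Suc i) (Suc i) * var_powi (Suc i) (1 - int n)) =
     (\<Prod>i\<in>{1..n}. f i i * var_powi i (1 - int n))"
    using prod.atLeast1_atMost_eq[of "\<lambda>i. f i i * var_powi i (1 - int n)" n] by simp
  moreover have "(\<Prod>(i, j)\<in>index_pairs n. kern (Suc i) (Suc j)) =
     (\<Prod>(i, j)\<in>{(i, j). 1 \<le> i \<and> i < j \<and> j \<le> n}. kern i j)"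
    by (rule prod.reindex_bij_witness[of _ "\<lambda>(i, j). (i - 1, j - 1)" "\<lambda>(i, j). (Suc i, Suc j)"]) auto
  ultimately show ?thesis by simp
qed

theorem theorem1p3:
  fixes n l u :: nat and s :: "nat \<Rightarrow> int" and S :: "int set"
  assumes "n \<ge> 1" and "l \<ge> 1" and "u \<le> n"
    and "strict_mono_on {1..u} s" and "\<forall>i\<in>{1..u}. s i \<le> -1"
    and "strict_mono_on {u+1..n} s" and "\<forall>i\<in>{u+1..n}. 1 \<le> s i"
    and "S = insert 0 (s ` {1..n})"
    and "centred_Catalan_set (n + 1) S"
  shows "int (AS_trapezoid_count n l S) =
    constant_term
      ((\<Prod>i\<in>{1..n}. var_powi i (- int n - s i)) *
       (\<Prod>i\<in>{u+1..n}. var_powi i (2 - int l) * (1 + var i) ^ l) *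
       (\<Prod>(i, j)\<in>{(i, j). 1 \<le> i \<and> i < j \<and> j \<le> n}.
          (var j - var i) * (1 + var i + var i * var j)))"
proof -
  \<comment> \<open>The column recorded by \<open>s i\<close>, inverting the relabelling in
    \<open>trapezoid_set\<close>.\<close>
  define k where "k i = (if i \<le> u then s i + 1 else s i + (int l - 1))" for i
  define K where "K = k ` {1..n}"
  have left: "k i = s i + 1" "s i \<le> -1" if "1 \<le> i" "i \<le> u" for i
    using that assms(5) by (auto simp: k_def)
  have right: "k i = s i + (int l - 1)" "1 \<le> s i" if "u < i" "i \<le> n" for i
    using that assms(7) by (auto simp: k_def)
  have k_less: "k i < k j" if "1 \<le> i" "i < j" "j \<le> n" for i j
  proof -
    consider "j \<le> u" | "i \<le> u" "u < j" | "u < i" by linarith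
    then show ?thesis
    proof cases
      case 1
      then have "s i < s j" using strict_mono_onD[OF assms(4), of i j] that by auto
      then show ?thesis using 1 that by (simp add: k_def)
    next
      case 2
      \<comment> \<open>Here \<open>k i \<le> 0 < int l \<le> k j\<close>.\<close>
      then show ?thesis using left[of i] right[of j] that assms(2) by auto
    next
      case 3
      then have "s i < s j" using strict_mono_onD[OF assms(6), of i j] that by auto
      then show ?thesis using 3 that by (simp add: k_def)
    qed
  qed
  have strict: "sorted_wrt (<) (map k [1..<Suc n])"
    by (auto simp: sorted_wrt_iff_nth_less k_less simp del: upt_Suc)
  have set_K: "set (map k [1..<Suc n]) = K"
    by (auto simp: K_def simp del: upt_Suc)
  have sorted_K: "sorted_list_of_set K = map k [1..<Suc n]"
    using strict set_K by (intro sorted_distinct_set_unique) (auto simp: strict_sorted_iff simp del: upt_Suc)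
  have finite_K: "finite K" by (simp add: K_def)
  have card_K: "card K = n"
    using distinct_card[of "map k [1..<Suc n]"] strict set_K by (simp add: strict_sorted_iff del: upt_Suc)
  have "{A. AS_trapezoid n l A \<and> trapezoid_set n l A = S} = arrays n l K"
  proof (rule trapezoids_eq_arrays)
    have k_cases: "(i \<le> u \<and> k i = s i + 1 \<and> s i \<le> -1) \<or> (u < i \<and> k i = s i + (int l - 1) \<and> 1 \<le> s i)"
      if "i \<in> {1..n}" for i
      using that left[of i] right[of i] by (cases "i \<le> u") auto
    show "K \<inter> {1..int l - 1} = {}" using k_cases by (force simp: K_def)
    show "x \<in> S \<longleftrightarrow> x + 1 \<in> K" if x: "x < 0" for x
    proof
      assume "x \<in> S"
      then obtain i where "i \<in> {1..n}" "x = s i" using x assms(8) by auto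
      then show "x + 1 \<in> K" using k_cases[of i] x by (auto simp: K_def intro!: image_eqI[of _ _ i])
    next
      assume "x + 1 \<in> K"
      then obtain i where i: "i \<in> {1..n}" "x + 1 = k i" by (auto simp: K_def)
      then have "x = s i" using k_cases[of i] x assms(2) by auto
      then show "x \<in> S" using i assms(8) by auto
    qed
    show "x \<in> S \<longleftrightarrow> x + (int l - 1) \<in> K" if x: "x > 0" for x
    proof
      assume "x \<in> S"
      then obtain i where "i \<in> {1..n}" "x = s i" using x assms(8) by auto
      then show "x + (int l - 1) \<in> K" using k_cases[of i] x by (auto simp: K_def intro!: image_eqI[of _ _ i])
    next
      assume "x + (int l - 1) \<in> K"
      then obtain i where i: "i \<in> {1..n}" "x + (int l - 1) = k i" by (auto simp: K_def)
      then have "x = s i" using k_cases[of i] x assms(2) by auto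
      then show "x \<in> S" using i assms(8) by auto
    qed
  qed (use assms in auto)
  then have "int (AS_trapezoid_count n l S) = Phi (map (\<lambda>i. wt l (k i)) [1..<Suc n])"
    unfolding AS_trapezoid_count_def
    using card_arrays_eq_Phi[of K n l] card_K finite_K by (simp add: sorted_K comp_def del: upt_Suc)
  also have "\<dots> = constant_term
    ((\<Prod>i\<in>{1..n}. wt l (k i) i * var_powi i (1 - int n)) *
     (\<Prod>(i, j)\<in>{(i, j). 1 \<le> i \<and> i < j \<and> j \<le> n}. kern i j))"
    using univariate_wt by (intro Phi_atLeast1) (auto simp: univariate_def)
  also have "(\<Prod>i\<in>{1..n}. wt l (k i) i * var_powi i (1 - int n)) =
    (\<Prod>i\<in>{1..n}. var_powi i (- int n - s i) * (if i \<in> {u+1..n} then var_powi i (2 - int l) * (1 + var i) ^ l else 1))"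
  proof (rule prod.cong[OF refl])
    fix i assume i: "i \<in> {1..n}"
    show "wt l (k i) i * var_powi i (1 - int n) =
      var_powi i (- int n - s i) * (if i \<in> {u+1..n} then var_powi i (2 - int l) * (1 + var i) ^ l else 1)"
    proof (cases "i \<le> u")
      case True
      \<comment> \<open>For \<open>s i = -1\<close> the column is 0, where the middle formula of
        \<open>wt\<close> gives 1.\<close>
      then have "wt l (k i) i = var_powi i (- s i - 1)"
        using left[of i] i by (cases "s i = -1") (auto simp: wt_def)
      then show ?thesis using True by (simp add: algebra_simps flip: var_powi_add)
    next
      case False
      then have si: "k i = s i + (int l - 1)" "1 \<le> s i" using right[of i] i by auto
      have "shift_var i ^ l = var_powi i (- int l) * (1 + var i) ^ l"
        by (simp add: power_mult_distrib var_powi_power mult.assoc[symmetric] flip: var_shift_var var_powi_add)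
      \<comment> \<open>For \<open>s i = 1\<close> the column is \<open>int l\<close>, the last one
        under the middle formula, and the power of the variable is 1.\<close>
      moreover have "wt l (k i) i = var_powi i (1 - s i) * shift_var i ^ l"
        using si by (cases "s i = 1") (auto simp: wt_def)
      ultimately have "wt l (k i) i * var_powi i (1 - int n) =
          (var_powi i (1 - s i) * var_powi i (- int l) * var_powi i (1 - int n)) * (1 + var i) ^ l"
        by (simp add: mult_ac)
      also have "var_powi i (1 - s i) * var_powi i (- int l) * var_powi i (1 - int n) =
          var_powi i (- int n - s i) * var_powi i (2 - int l)"
        by (simp add: algebra_simps flip: var_powi_add)
      finally show ?thesis using False i by (simp add: mult.assoc)
    qed
  qed
  also have "\<dots> = (\<Prod>i\<in>{1..n}. var_powi i (- int n - s i)) *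
       (\<Prod>i\<in>{u+1..n}. var_powi i (2 - int l) * (1 + var i) ^ l)"
  proof -
    have "(\<Prod>i\<in>{1..n}. if i \<in> {u+1..n} then var_powi i (2 - int l) * (1 + var i) ^ l else 1) =
       (\<Prod>i\<in>{u+1..n}. var_powi i (2 - int l) * (1 + var i) ^ l)"
      by (rule prod.mono_neutral_cong_right) auto
    then show ?thesis by (simp add: prod.distrib)
  qed
  finally show ?thesis by (simp add: kern_def)
qed

end
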